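(* Let $t>n\ge1$, and set $\ell=t-n$, $a=\lfloor t/\ell\rfloor$, $r=t-a\ell$. Let $A$ be the maximum of $s_{\boldsymbol\mu}$ over all $t$-doped POVMs on $n$ data qubits. Then every $t$-doped POVM satisfies $s_{\boldsymbol\mu}\le A$, where $$A\ge 2^{-\ell}\,(3^{a+1}-1)^{r}\,(3^{a}-1)^{\ell-r}.$$
   Context: A $t$-doped POVM on $n$ data qubits: $m\ge 0$ ancilla qubits in a stabilizer state $\ket\psi$, a unitary $U$ on $n+m$ qubits given by a circuit of Clifford gates (generated by Hadamard, phase $S$, CNOT) and exactly $t$ gates $T=\mathrm{diag}(1,e^{i\pi/4})$, and a measurement in a stabilizer basis $\{\ket{\Phi'_b}\}$ of $n+m$ qubits (common eigenbasis of $n+m$ independent commuting Pauli operators). Its elements are $\mu_b=(I\otimes\bra\psi)U^\dagger\ket{\Phi'_b}\!\bra{\Phi'_b}U(I\otimes\ket\psi)$, operators on $(\mathbb{C}^2)^{\otimes n}$, and $s_{\boldsymbol\mu}=\dim\operatorname{span}\{\mu_b\}$. *)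

theory Defs
  imports Complex_Main "Jordan_Normal_Form.Matrix"
begin

text \<open>Computational basis index x of a k-qubit system; qubit q carries bit qbit x q.\<close>
definition qbit :: "nat \<Rightarrow> nat \<Rightarrow> nat" where
  "qbit x q = (x div 2 ^ q) mod 2"

definition flipbit :: "nat \<Rightarrow> nat \<Rightarrow> nat" where
  "flipbit x q = (if qbit x q = 0 then x + 2 ^ q else x - 2 ^ q)"

definition cadj :: "complex mat \<Rightarrow> complex mat" where
  "cadj A = mat (dim_col A) (dim_row A) (\<lambda>(i,j). cnj (A $$ (j,i)))"

definition cinner :: "complex vec \<Rightarrow> complex vec \<Rightarrow> complex" where
  "cinner v w = (\<Sum>i<dim_vec v. cnj (v $ i) * w $ i)"

definition outer :: "complex vec \<Rightarrow> complex mat" where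
  "outer v = mat (dim_vec v) (dim_vec v) (\<lambda>(i,j). v $ i * cnj (v $ j))"

datatype gate = Had nat | Sg nat | Tg nat | CNOT nat nat

definition had1 :: "nat \<Rightarrow> nat \<Rightarrow> complex" where
  "had1 a b = (if a = 1 \<and> b = 1 then -1 else 1) / complex_of_real (sqrt 2)"

definition s1 :: "nat \<Rightarrow> nat \<Rightarrow> complex" where
  "s1 a b = (if a \<noteq> b then 0 else if a = 0 then 1 else \<i>)"

definition t1 :: "nat \<Rightarrow> nat \<Rightarrow> complex" where
  "t1 a b = (if a \<noteq> b then 0 else if a = 0 then 1 else cis (pi / 4))"

definition single_on :: "nat \<Rightarrow> nat \<Rightarrow> (nat \<Rightarrow> nat \<Rightarrow> complex) \<Rightarrow> complex mat" where
  "single_on k j G = mat (2 ^ k) (2 ^ k) (\<lambda>(x,y).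
     if (\<forall>q<k. q \<noteq> j \<longrightarrow> qbit x q = qbit y q) then G (qbit x j) (qbit y j) else 0)"

definition cnot_on :: "nat \<Rightarrow> nat \<Rightarrow> nat \<Rightarrow> complex mat" where
  "cnot_on k c tg = mat (2 ^ k) (2 ^ k) (\<lambda>(x,y).
     if x = (if qbit y c = 1 then flipbit y tg else y) then 1 else 0)"

fun gate_mat :: "nat \<Rightarrow> gate \<Rightarrow> complex mat" where
  "gate_mat k (Had j) = single_on k j had1"
| "gate_mat k (Sg j) = single_on k j s1"
| "gate_mat k (Tg j) = single_on k j t1"
| "gate_mat k (CNOT c tg) = cnot_on k c tg"

fun valid_gate :: "nat \<Rightarrow> gate \<Rightarrow> bool" where
  "valid_gate k (Had j) = (j < k)"
| "valid_gate k (Sg j) = (j < k)"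
| "valid_gate k (Tg j) = (j < k)"
| "valid_gate k (CNOT c tg) = (c < k \<and> tg < k \<and> c \<noteq> tg)"

fun is_T :: "gate \<Rightarrow> bool" where
  "is_T (Tg _) = True"
| "is_T _ = False"

definition t_count :: "gate list \<Rightarrow> nat" where
  "t_count gs = length (filter is_T gs)"

text \<open>Circuit unitary; the first gate of the list is applied first.\<close>
fun circ_mat :: "nat \<Rightarrow> gate list \<Rightarrow> complex mat" where
  "circ_mat k [] = 1\<^sub>m (2 ^ k)"
| "circ_mat k (g # gs) = circ_mat k gs * gate_mat k g"

text \<open>Single-qubit Paulis: 0 = I, 1 = X, 2 = Y, 3 = Z.\<close>
definition pauli1 :: "nat \<Rightarrow> nat \<Rightarrow> nat \<Rightarrow> complex" where
  "pauli1 p a b =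
     (if p = 0 then (if a = b then 1 else 0)
      else if p = 1 then (if a \<noteq> b then 1 else 0)
      else if p = 2 then (if a = 0 \<and> b = 1 then - \<i> else if a = 1 \<and> b = 0 then \<i> else 0)
      else (if a \<noteq> b then 0 else if a = 0 then 1 else -1))"

text \<open>A k-qubit Pauli operator: phase i^ph times a tensor product of single-qubit Paulis.\<close>
type_synonym pauli = "nat \<times> (nat \<Rightarrow> nat)"

definition pauli_mat :: "nat \<Rightarrow> pauli \<Rightarrow> complex mat" where
  "pauli_mat k P = mat (2 ^ k) (2 ^ k) (\<lambda>(x,y).
     \<i> ^ fst P * (\<Prod>q<k. pauli1 (snd P q) (qbit x q) (qbit y q)))"

definition valid_pauli :: "nat \<Rightarrow> pauli \<Rightarrow> bool" where
  "valid_pauli k P = (\<forall>q<k. snd P q \<le> 3)"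

definition xpart :: "nat \<Rightarrow> bool" where "xpart p = (p = 1 \<or> p = 2)"
definition zpart :: "nat \<Rightarrow> bool" where "zpart p = (p = 2 \<or> p = 3)"

text \<open>Independence: the binary (symplectic) vectors of the Paulis are linearly
  independent over GF(2), i.e. no nonempty product of them is proportional to I.\<close>
definition independent_paulis :: "nat \<Rightarrow> pauli list \<Rightarrow> bool" where
  "independent_paulis k Ps = (\<forall>S \<subseteq> {..<length Ps}. S \<noteq> {} \<longrightarrow>
     (\<exists>q<k. odd (card {i\<in>S. xpart (snd (Ps ! i) q)}) \<or> odd (card {i\<in>S. zpart (snd (Ps ! i) q)})))"

definition commuting_paulis :: "nat \<Rightarrow> pauli list \<Rightarrow> bool" where
  "commuting_paulis k Ps = (\<forall>P\<in>set Ps. \<forall>Q\<in>set Ps. pauli_mat k P * pauli_mat k Q = pauli_mat k Q * pauli_mat k P)"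

definition good_paulis :: "nat \<Rightarrow> pauli list \<Rightarrow> bool" where
  "good_paulis k Ps = (length Ps = k \<and> (\<forall>P\<in>set Ps. valid_pauli k P)
     \<and> independent_paulis k Ps \<and> commuting_paulis k Ps)"

definition stabilizer_state :: "nat \<Rightarrow> complex vec \<Rightarrow> bool" where
  "stabilizer_state m \<psi> = (dim_vec \<psi> = 2 ^ m \<and> cinner \<psi> \<psi> = 1 \<and>
     (\<exists>Ps. good_paulis m Ps \<and> (\<forall>P\<in>set Ps. pauli_mat m P *\<^sub>v \<psi> = \<psi>)))"

definition stabilizer_basis :: "nat \<Rightarrow> (nat \<Rightarrow> complex vec) \<Rightarrow> bool" where
  "stabilizer_basis k \<Phi> = (\<exists>Ps. good_paulis k Ps \<and>
     (\<forall>b<2 ^ k. dim_vec (\<Phi> b) = 2 ^ k \<and>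
        (\<forall>P\<in>set Ps. \<exists>ev. pauli_mat k P *\<^sub>v \<Phi> b = ev \<cdot>\<^sub>v \<Phi> b)) \<and>
     (\<forall>b<2 ^ k. \<forall>c<2 ^ k. cinner (\<Phi> b) (\<Phi> c) = (if b = c then 1 else 0)))"

text \<open>Data qubits are qubits 0..n-1, ancillas are qubits n..n+m-1, so the index of
  basis state x (data) tensor y (ancilla) is x + 2^n * y.  embed = I tensor |psi>.\<close>
definition embed :: "nat \<Rightarrow> nat \<Rightarrow> complex vec \<Rightarrow> complex mat" where
  "embed n m \<psi> = mat (2 ^ (n + m)) (2 ^ n) (\<lambda>(i,j). if i mod 2 ^ n = j then \<psi> $ (i div 2 ^ n) else 0)"

definition povm_elem :: "nat \<Rightarrow> nat \<Rightarrow> complex vec \<Rightarrow> complex mat \<Rightarrow> complex vec \<Rightarrow> complex mat" where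
  "povm_elem n m \<psi> U \<phi> = cadj (embed n m \<psi>) * cadj U * outer \<phi> * U * embed n m \<psi>"

definition lin_indep_mats :: "nat \<Rightarrow> complex mat set \<Rightarrow> bool" where
  "lin_indep_mats d T = (\<forall>c :: complex mat \<Rightarrow> complex.
     (\<forall>i<d. \<forall>j<d. (\<Sum>M\<in>T. c M * M $$ (i,j)) = 0) \<longrightarrow> (\<forall>M\<in>T. c M = 0))"

definition span_dim :: "nat \<Rightarrow> complex mat set \<Rightarrow> nat" where
  "span_dim d S = Max (card ` {T. T \<subseteq> S \<and> finite T \<and> lin_indep_mats d T})"

definition tdoped_s :: "nat \<Rightarrow> nat \<Rightarrow> nat \<Rightarrow> bool" where
  "tdoped_s n t s = (\<exists>m \<psi> gs \<Phi>.
     stabilizer_state m \<psi> \<and> (\<forall>g\<in>set gs. valid_gate (n + m) g) \<and> t_count gs = t \<and>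
     stabilizer_basis (n + m) \<Phi> \<and>
     s = span_dim (2 ^ n) {povm_elem n m \<psi> (circ_mat (n + m) gs) (\<Phi> b) | b. b < 2 ^ (n + m)})"

end

theory Submission
  imports Defs "HOL-Library.Function_Algebras" "HOL-Library.FuncSet"
begin

text \<open>All dimensions are at most 4^n, so the maximum exists. For the lower bound, prepare ancillas
  in a zero state and use them to apply a uniformly random known Pauli operator to the data; then one
  fixed outcome contributes all Pauli conjugates of a single rank-one operator, and by Fourier
  inversion their span consists of the Paulis in the support of that operator.

  The data qubits are split into l blocks. Each block receives one T gate acting on its parity
  (computed into a shared ancilla), and each data qubit is then sent through H T H, for l + n = t
  T gates in total. On a block of k qubits the single-qubit gates alone give support on the strings
  over {I, Y, Z}; the parity rotation adds the strings over {I, X, Z} with an odd number of X.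
  This makes 3^k + (3^k - 1)/2 = (3^(k+1) - 1)/2 Paulis per block. Blocks are the residue classes
  modulo l, whence r of them have a qubits and the others a - 1.\<close>

text \<open>Write F for the \<open>fiducial\<close> vector. Up to a nonzero factor, the coefficient
  of Z^z X^x in the conjugated operators is <F| Z^z X^x |F>, and the obstacle is to show that it
  does not vanish. One qubit behind H T H has amplitudes (1 + \<omega>)/2 and (1 - \<omega>)/2; its
  X expectation is 0 because |\<omega>| = 1, whereas I, Y and Z survive. The parity phase of a block
  contributes the factor 1 if x has even parity there, and (1 + i (-1)^p)/sqrt 2 otherwise, where p
  is the parity of the summation variable. The odd case is a sum of two choices: keep the string of
  the block, or multiply it by Z on every qubit, which exchanges X with Y and I with Z. An odd block
  has at least one X or Y, and that qubit becomes X, hence 0, under one of the two choices. So the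
  choices never interfere, and an odd string over {I, X, Z} survives because its flip is a string
  over {I, Y, Z}. Strings over {I, X, Z} with an even number of X outnumber the odd ones by (2 -
  1)^k = 1, which is where (3^k - 1)/2 comes from.\<close>

unbundle bit_operations_syntax

section \<open>Dimension bounds\<close>

interpretation fun_vs: vector_space "\<lambda>(c::complex) (f::nat \<times> nat \<Rightarrow> complex) p. c * f p"
  by unfold_locales (auto simp: fun_eq_iff algebra_simps)

definition entries :: "nat \<Rightarrow> complex mat \<Rightarrow> nat \<times> nat \<Rightarrow> complex" where
  "entries d M = (\<lambda>(i,j). if i < d \<and> j < d then M $$ (i,j) else 0)"

lemma sum_fun_apply: "(\<Sum>k\<in>K. f k) p = (\<Sum>k\<in>K. f k p)"
  for f :: "'k \<Rightarrow> 'b \<Rightarrow> 'c::comm_monoid_add"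
  by (induction K rule: infinite_finite_induct) auto

text \<open>Injectivity is a genuine part of the equivalence: two matrices with the same d x d
  corner are dependent as a family, but \<open>entries d\<close> merges them and their image may
  stay independent.\<close>

lemma lin_indep_mats_entries:
  assumes "finite T"
  shows "lin_indep_mats d T \<longleftrightarrow> inj_on (entries d) T \<and> fun_vs.independent (entries d ` T)"
proof -
  have eq: "(\<forall>i<d. \<forall>j<d. (\<Sum>M\<in>T. c M * M $$ (i,j)) = 0) \<longleftrightarrow>
      (\<Sum>M\<in>T. (\<lambda>p. c M * entries d M p)) = 0" for c :: "complex mat \<Rightarrow> complex"
  proof -
    have "(\<Sum>M\<in>T. (\<lambda>p. c M * entries d M p)) =
        (\<lambda>(i,j). if i < d \<and> j < d then \<Sum>M\<in>T. c M * M $$ (i,j) else 0)"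
      by (auto simp: fun_eq_iff sum_fun_apply entries_def)
    then show ?thesis by (auto simp: fun_eq_iff)
  qed
  show ?thesis
  proof
    assume L: "lin_indep_mats d T"
    have inj: "inj_on (entries d) T"
    proof (rule inj_onI, rule ccontr)
      fix M N assume MN: "M \<in> T" "N \<in> T" "entries d M = entries d N" "M \<noteq> N"
      define c :: "complex mat \<Rightarrow> complex" where "c = (\<lambda>K. if K = M then 1 else if K = N then -1 else 0)"
      have "(\<Sum>K\<in>T. (\<lambda>p. c K * entries d K p)) = (\<Sum>K\<in>{M,N}. (\<lambda>p. c K * entries d K p))"
        by (rule sum.mono_neutral_right) (use assms MN in \<open>auto simp: c_def fun_eq_iff\<close>)
      also have "\<dots> = 0" using MN by (auto simp: c_def fun_eq_iff)
      finally have "c M = 0" using L MN(1) unfolding lin_indep_mats_def eq by blast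
      then show False by (simp add: c_def)
    qed
    moreover have "fun_vs.independent (entries d ` T)"
    proof (rule fun_vs.independent_if_scalars_zero)
      fix f v assume 0: "(\<Sum>x\<in>entries d ` T. (\<lambda>p. f x * x p)) = 0" and "v \<in> entries d ` T"
      then obtain M where "M \<in> T" "v = entries d M" by auto
      moreover have "(\<Sum>M\<in>T. (\<lambda>p. f (entries d M) * entries d M p)) = 0"
        using 0 by (subst (asm) sum.reindex[OF inj]) (simp add: o_def)
      ultimately show "f v = 0" using L unfolding lin_indep_mats_def eq by auto
    qed (use assms in auto)
    ultimately show "inj_on (entries d) T \<and> fun_vs.independent (entries d ` T)" by blast
  next
    assume R: "inj_on (entries d) T \<and> fun_vs.independent (entries d ` T)"
    show "lin_indep_mats d T"
      unfolding lin_indep_mats_def eq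
    proof (intro allI impI ballI)
      fix c :: "complex mat \<Rightarrow> complex" and M
      assume 0: "(\<Sum>M\<in>T. (\<lambda>p. c M * entries d M p)) = 0" and M: "M \<in> T"
      let ?f = "\<lambda>x. c (the_inv_into T (entries d) x)"
      have sum0: "(\<Sum>x\<in>entries d ` T. (\<lambda>p. ?f x * x p)) = 0"
        using R 0 by (subst sum.reindex) (auto simp: the_inv_into_f_f)
      have indep: "\<not> (\<exists>u. (\<exists>v\<in>entries d ` T. u v \<noteq> 0) \<and> (\<Sum>v\<in>entries d ` T. (\<lambda>p. u v * v p)) = 0)"
        using R assms fun_vs.dependent_finite[of "entries d ` T"] by simp
      have "?f (entries d M) = 0"
      proof (rule ccontr)
        assume "?f (entries d M) \<noteq> 0"
        then have "\<exists>v\<in>entries d ` T. ?f v \<noteq> 0" using M by blast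
        then have "\<exists>u. (\<exists>v\<in>entries d ` T. u v \<noteq> 0) \<and> (\<Sum>v\<in>entries d ` T. (\<lambda>p. u v * v p)) = 0"
          using sum0 by (intro exI[of _ ?f] conjI)
        with indep show False by (rule notE)
      qed
      then show "c M = 0" using R M by (simp add: the_inv_into_f_f)
    qed
  qed
qed

definition unit_fun :: "nat \<times> nat \<Rightarrow> nat \<times> nat \<Rightarrow> complex" where
  "unit_fun p = (\<lambda>q. of_bool (q = p))"

lemma card_lin_indep_mats_le:
  assumes "finite T" "lin_indep_mats d T"
  shows "card T \<le> d * d"
proof -
  let ?U = "unit_fun ` ({..<d} \<times> {..<d})"
  have "entries d M \<in> fun_vs.span ?U" for M
  proof -
    have "entries d M = (\<Sum>p\<in>{..<d} \<times> {..<d}. (\<lambda>q. entries d M p * unit_fun p q))"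
      by (auto simp: fun_eq_iff sum_fun_apply unit_fun_def entries_def)
    also have "\<dots> \<in> fun_vs.span ?U"
      by (intro fun_vs.span_sum fun_vs.span_scale fun_vs.span_base) auto
    finally show ?thesis .
  qed
  then have "card (entries d ` T) \<le> card ?U"
    using assms lin_indep_mats_entries by (intro conjunct2[OF fun_vs.independent_span_bound]) auto
  also have "\<dots> \<le> d * d" using card_image_le[of "{..<d} \<times> {..<d}" unit_fun] by simp
  finally show ?thesis using assms lin_indep_mats_entries card_image by metis
qed

text \<open>\<open>span_dim\<close> is a \<open>Max\<close>, which carries no information on an
  infinite set; the uniform bound d * d gives it meaning for every S.\<close>

lemma finite_lin_indep_cards: "finite (card ` {T. T \<subseteq> S \<and> finite T \<and> lin_indep_mats d T})"
  by (rule finite_subset[of _ "{..d * d}"]) (auto simp: card_lin_indep_mats_le)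

lemma span_dim_le: "span_dim d S \<le> d * d"
proof -
  have "{} \<in> {T. T \<subseteq> S \<and> finite T \<and> lin_indep_mats d T}" by (simp add: lin_indep_mats_def)
  then have "card ` {T. T \<subseteq> S \<and> finite T \<and> lin_indep_mats d T} \<noteq> {}" by blast
  then show ?thesis unfolding span_dim_def
    using finite_lin_indep_cards by (subst Max_le_iff) (auto simp: card_lin_indep_mats_le)
qed

text \<open>An orthogonal family with e \<noteq> 0 is independent, so it cannot outnumber a maximal
  independent set of matrices \<open>M k\<close>. The pairing is bilinear rather than Hermitian,
  which fits the real-valued Pauli functions substituted for P.\<close>

lemma span_dim_ge_card:
  fixes P :: "'g \<Rightarrow> nat \<times> nat \<Rightarrow> complex" and M :: "'k \<Rightarrow> complex mat"
  assumes "finite K" "finite G"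
    and M: "\<And>k. k \<in> K \<Longrightarrow> M k \<in> S"
    and P: "\<And>g i j. g \<in> G \<Longrightarrow> i < d \<Longrightarrow> j < d \<Longrightarrow> P g (i,j) = (\<Sum>k\<in>K. c g k * M k $$ (i,j))"
    and orth: "\<And>g h. g \<in> G \<Longrightarrow> h \<in> G \<Longrightarrow>
      (\<Sum>p\<in>{..<d} \<times> {..<d}. P g p * P h p) = (if g = h then e else 0)"
    and "e \<noteq> 0"
  shows "card G \<le> span_dim d S"
proof -
  obtain B where B: "B \<subseteq> entries d ` M ` K" "fun_vs.independent B" "entries d ` M ` K \<subseteq> fun_vs.span B"
    using fun_vs.maximal_independent_subset by blast
  then obtain T where T: "T \<subseteq> M ` K" "inj_on (entries d) T" "B = entries d ` T"
    by (auto simp: subset_image_inj)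
  have finT: "finite T" using T(1) \<open>finite K\<close> finite_subset by blast
  \<comment> \<open>Cutting P off outside the d x d corner turns the entrywise identity for P into
    an equality of functions, so that Q lies in the span of the \<open>entries\<close>.\<close>
  define Q where "Q g = (\<lambda>p. if p \<in> {..<d} \<times> {..<d} then P g p else 0)" for g
  have orthQ: "(\<Sum>p\<in>{..<d} \<times> {..<d}. Q g p * P h p) = (if g = h then e else 0)"
    if "g \<in> G" "h \<in> G" for g h
    using orth[OF that] by (simp add: Q_def)
  have injQ: "inj_on Q G"
    using orthQ \<open>e \<noteq> 0\<close> by (intro inj_onI) metis
  have indep: "fun_vs.independent (Q ` G)"
  proof (rule fun_vs.independent_if_scalars_zero)
    fix f v assume 0: "(\<Sum>x\<in>Q ` G. (\<lambda>p. f x * x p)) = 0" and "v \<in> Q ` G"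
    then obtain h where h: "h \<in> G" "v = Q h" by auto
    have 1: "(\<Sum>g\<in>G. f (Q g) * Q g p) = 0" for p
      using fun_cong[OF 0, of p] injQ by (simp add: sum_fun_apply sum.reindex o_def)
    have "0 = (\<Sum>p\<in>{..<d} \<times> {..<d}. (\<Sum>g\<in>G. f (Q g) * Q g p) * P h p)" by (simp add: 1)
    also have "\<dots> = (\<Sum>p\<in>{..<d} \<times> {..<d}. \<Sum>g\<in>G. f (Q g) * (Q g p * P h p))"
      by (simp add: sum_distrib_right mult.assoc)
    also have "\<dots> = (\<Sum>g\<in>G. f (Q g) * (\<Sum>p\<in>{..<d} \<times> {..<d}. Q g p * P h p))"
      by (subst sum.swap) (simp add: sum_distrib_left)
    also have "\<dots> = (\<Sum>g\<in>G. if g = h then f (Q g) * e else 0)"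
      using orthQ h by (intro sum.cong) auto
    also have "\<dots> = f (Q h) * e" using h \<open>finite G\<close> by simp
    finally show "f v = 0" using h \<open>e \<noteq> 0\<close> by simp
  qed (use \<open>finite G\<close> in simp)
  have "Q g \<in> fun_vs.span B" if "g \<in> G" for g
  proof -
    have "Q g = (\<Sum>k\<in>K. (\<lambda>p. c g k * entries d (M k) p))"
      using P[OF that] by (auto simp: fun_eq_iff sum_fun_apply Q_def entries_def)
    also have "\<dots> \<in> fun_vs.span B"
      using B(3) by (intro fun_vs.span_sum fun_vs.span_scale) auto
    finally show ?thesis .
  qed
  then have "card (Q ` G) \<le> card B"
    using indep finT T(3) by (intro conjunct2[OF fun_vs.independent_span_bound]) auto
  then have "card G \<le> card T"
    using injQ T by (simp add: card_image)
  also have "\<dots> \<le> span_dim d S"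
    unfolding span_dim_def using finite_lin_indep_cards
  proof (rule Max_ge)
    have "T \<subseteq> S" "lin_indep_mats d T" using T B finT M by (auto simp: lin_indep_mats_entries)
    then show "card T \<in> card ` {T. T \<subseteq> S \<and> finite T \<and> lin_indep_mats d T}" using finT by blast
  qed
  finally show ?thesis .
qed

section \<open>Circuits acting on row functionals\<close>

lemma qbit_eq_of_bool_bit: "qbit x q = of_bool (bit x q)"
  by (simp add: qbit_def bit_iff_odd mod_2_eq_odd)

lemma bit_nat_less_exp: "x < 2 ^ k \<Longrightarrow> bit (x::nat) q \<Longrightarrow> q < k"
  by (metis bit_take_bit_iff take_bit_nat_eq_self)

lemma nat_eq_if_bits_eq:
  "x < 2 ^ k \<Longrightarrow> y < 2 ^ k \<Longrightarrow> (\<And>q. q < k \<Longrightarrow> bit x q = bit y q) \<Longrightarrow> x = (y::nat)"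
  by (rule bit_eqI) (metis bit_nat_less_exp)

definition of_bits :: "nat \<Rightarrow> (nat \<Rightarrow> bool) \<Rightarrow> nat" where
  "of_bits k p = horner_sum of_bool 2 (map p [0..<k])"

lemma bit_of_bits: "bit (of_bits k p) q \<longleftrightarrow> q < k \<and> p q"
  by (auto simp: of_bits_def bit_horner_sum_bit_iff)

lemma of_bits_less: "of_bits k p < 2 ^ k"
  using horner_sum_of_bool_2_less[of "map p [0..<k]"] by (simp add: of_bits_def)

lemma bit_flipbit: "bit (flipbit x t) q \<longleftrightarrow> bit x q \<noteq> (q = t)"
proof -
  have "x = unset_bit t x + 2 ^ t" if "bit x t"
  proof -
    have "x = set_bit t (unset_bit t x)" using that by (auto intro!: bit_eqI simp: bit_simps)
    then show ?thesis by (simp add: set_bit_eq bit_unset_bit_iff)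
  qed
  then have "x - 2 ^ t = unset_bit t x" if "bit x t"
    using that by (metis add_diff_cancel_right')
  then have "flipbit x t = flip_bit t x"
    by (auto simp: flipbit_def qbit_eq_of_bool_bit flip_bit_eq_if set_bit_eq)
  then show ?thesis by (auto simp: bit_flip_bit_iff)
qed

lemma flipbit_less: "x < 2 ^ k \<Longrightarrow> t < k \<Longrightarrow> flipbit x t < 2 ^ k"
proof -
  assume "x < 2 ^ k" "t < k"
  then have "flipbit x t = of_bits k (bit (flipbit x t))"
    by (intro bit_eqI) (auto simp: bit_of_bits bit_flipbit dest: bit_nat_less_exp)
  then show ?thesis using of_bits_less by metis
qed

definition \<omega> :: complex where "\<omega> = cis (pi / 4)"

definition sgn_bit :: "bool \<Rightarrow> complex" where "sgn_bit b = (if b then -1 else 1)"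

text \<open>Row functionals are pulled back through gates, so a row of the circuit unitary is obtained
  by processing the gate list from its end; basis states are represented by their bit functions.\<close>

fun pull :: "gate \<Rightarrow> ((nat \<Rightarrow> bool) \<Rightarrow> complex) \<Rightarrow> (nat \<Rightarrow> bool) \<Rightarrow> complex" where
  "pull (Had j) R y = (R (y(j := False)) + sgn_bit (y j) * R (y(j := True))) / complex_of_real (sqrt 2)"
| "pull (Sg j) R y = (if y j then \<i> else 1) * R y"
| "pull (Tg j) R y = (if y j then \<omega> else 1) * R y"
| "pull (CNOT c t) R y = R (y(t := (y t \<noteq> y c)))"

fun pulls :: "gate list \<Rightarrow> ((nat \<Rightarrow> bool) \<Rightarrow> complex) \<Rightarrow> (nat \<Rightarrow> bool) \<Rightarrow> complex" where
  "pulls [] R = R"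
| "pulls (g # gs) R = pull g (pulls gs R)"

lemma pulls_append: "pulls (gs @ hs) R = pulls gs (pulls hs R)"
  by (induction gs) auto

lemma gate_mat_carrier [simp]: "gate_mat k g \<in> carrier_mat (2 ^ k) (2 ^ k)"
  by (cases g) (auto simp: single_on_def cnot_on_def)

lemma circ_mat_carrier [simp]: "circ_mat k gs \<in> carrier_mat (2 ^ k) (2 ^ k)"
  by (induction gs) (auto intro: mult_carrier_mat gate_mat_carrier)

text \<open>Only the two rows that agree with y outside bit j can contribute to column y;
  \<open>z False\<close> and \<open>z True\<close> are these rows.\<close>

lemma sum_single_on:
  assumes "j < k" "y < 2 ^ k"
  shows "(\<Sum>x<2 ^ k. R (bit x) * single_on k j G $$ (x, y)) =
    R ((bit y)(j := False)) * G 0 (of_bool (bit y j)) + R ((bit y)(j := True)) * G 1 (of_bool (bit y j))"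
proof -
  define z where "z b = of_bits k ((bit y)(j := b))" for b
  have z: "bit (z b) = (bit y)(j := b)" for b
    using assms by (auto simp: z_def bit_of_bits fun_eq_iff dest: bit_nat_less_exp)
  have zl: "z b < 2 ^ k" for b by (simp add: z_def of_bits_less)
  have ne: "z False \<noteq> z True" by (metis fun_upd_same z)
  have mem: "(\<forall>q<k. q \<noteq> j \<longrightarrow> bit x q = bit y q) \<longleftrightarrow> x \<in> {z False, z True}" if "x < 2 ^ k" for x
  proof
    assume "\<forall>q<k. q \<noteq> j \<longrightarrow> bit x q = bit y q"
    then have "x = z (bit x j)" using that zl by (intro nat_eq_if_bits_eq[of x k]) (auto simp: z)
    then show "x \<in> {z False, z True}" by (cases "bit x j") auto
  qed (auto simp: z)
  have "(\<Sum>x<2 ^ k. R (bit x) * single_on k j G $$ (x, y)) =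
      (\<Sum>x<2 ^ k. if x \<in> {z False, z True} then R (bit x) * G (of_bool (bit x j)) (of_bool (bit y j)) else 0)"
  proof (intro sum.cong refl)
    fix x :: nat assume "x \<in> {..<2 ^ k}"
    then have x: "x < 2 ^ k" by simp
    have "single_on k j G $$ (x, y) =
        (if \<forall>q<k. q \<noteq> j \<longrightarrow> bit x q = bit y q then G (of_bool (bit x j)) (of_bool (bit y j)) else 0)"
      unfolding single_on_def qbit_eq_of_bool_bit index_mat(1)[OF x assms(2)] prod.case of_bool_eq_iff ..
    then show "R (bit x) * single_on k j G $$ (x, y) =
        (if x \<in> {z False, z True} then R (bit x) * G (of_bool (bit x j)) (of_bool (bit y j)) else 0)"
      unfolding mem[OF x] by simp
  qed
  also have "\<dots> = (\<Sum>x\<in>{z False, z True}. R (bit x) * G (of_bool (bit x j)) (of_bool (bit y j)))"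
    using zl by (intro sum.mono_neutral_cong_right) auto
  also have "\<dots> = R ((bit y)(j := False)) * G 0 (of_bool (bit y j)) + R ((bit y)(j := True)) * G 1 (of_bool (bit y j))"
    using ne by (simp add: z)
  finally show ?thesis .
qed

lemma sum_gate_mat:
  assumes "valid_gate k g" "y < 2 ^ k"
  shows "(\<Sum>x<2 ^ k. R (bit x) * gate_mat k g $$ (x, y)) = pull g R (bit y)"
proof (cases g)
  case (Had j)
  then show ?thesis using assms by (simp add: sum_single_on had1_def sgn_bit_def field_simps)
next
  case (Sg j)
  then have "(bit y)(j := bit y j) = bit y" by simp
  then show ?thesis using Sg assms by (cases "bit y j") (simp_all add: sum_single_on s1_def)
next
  case (Tg j)
  then have "(bit y)(j := bit y j) = bit y" by simp
  then show ?thesis using Tg assms by (cases "bit y j") (simp_all add: sum_single_on t1_def \<omega>_def)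
next
  case (CNOT c t)
  let ?y = "if bit y c then flipbit y t else y"
  have "(\<Sum>x<2 ^ k. R (bit x) * gate_mat k g $$ (x, y)) = (\<Sum>x<2 ^ k. if x = ?y then R (bit x) else 0)"
    using assms CNOT by (intro sum.cong) (auto simp: cnot_on_def qbit_eq_of_bool_bit)
  also have "\<dots> = R (bit ?y)" using assms CNOT flipbit_less by (subst sum.delta) auto
  also have "bit ?y = (bit y)(t := (bit y t \<noteq> bit y c))" by (auto simp: bit_flipbit fun_eq_iff)
  finally show ?thesis using CNOT by (simp add: fun_upd_def)
qed

lemma circ_mat_row:
  assumes "\<And>g. g \<in> set gs \<Longrightarrow> valid_gate k g" "b < 2 ^ k" "y < 2 ^ k"
  shows "circ_mat k gs $$ (b, y) = pulls gs (\<lambda>y. of_bool (\<forall>q<k. y q = bit b q)) (bit y)"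
  using assms
proof (induction gs arbitrary: y)
  case Nil
  then show ?case using nat_eq_if_bits_eq[of b k y] by (auto simp: one_mat_def)
next
  case (Cons g gs)
  have "circ_mat k (g # gs) $$ (b, y) = (\<Sum>x<2 ^ k. circ_mat k gs $$ (b, x) * gate_mat k g $$ (x, y))"
    using Cons.prems(2,3) carrier_matD[OF circ_mat_carrier[of k gs]] carrier_matD[OF gate_mat_carrier[of k g]]
    by (simp add: scalar_prod_def atLeast0LessThan)
  also have "\<dots> = (\<Sum>x<2 ^ k. pulls gs (\<lambda>y. of_bool (\<forall>q<k. y q = bit b q)) (bit x) * gate_mat k g $$ (x, y))"
    using Cons by (intro sum.cong) auto
  also have "\<dots> = pulls (g # gs) (\<lambda>y. of_bool (\<forall>q<k. y q = bit b q)) (bit y)"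
    using Cons.prems by (subst sum_gate_mat) auto
  finally show ?case .
qed

section \<open>Closed forms for the building blocks of the circuit\<close>

definition par :: "nat list \<Rightarrow> (nat \<Rightarrow> bool) \<Rightarrow> bool" where
  "par qs y = foldr (\<lambda>q b. y q \<noteq> b) qs False"

lemma par_simps [simp]: "par [] y = False" "par (q # qs) y \<longleftrightarrow> y q \<noteq> par qs y"
  by (simp_all add: par_def)

lemma par_cong: "(\<And>q. q \<in> set qs \<Longrightarrow> y q = z q) \<Longrightarrow> par qs y = par qs z"
  by (induction qs) auto

lemma sgn_bit_xor: "sgn_bit (a \<noteq> b) = sgn_bit a * sgn_bit b"
  by (auto simp: sgn_bit_def)

lemma sgn_bit_par: "distinct qs \<Longrightarrow> sgn_bit (par qs y) = (\<Prod>q\<in>set qs. sgn_bit (y q))"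
proof (induction qs)
  case (Cons q qs)
  have "sgn_bit (par (q # qs) y) = sgn_bit (y q) * sgn_bit (par qs y)"
    by (simp only: par_simps sgn_bit_xor)
  then show ?case using Cons by simp
qed (simp add: sgn_bit_def)

definition parity_phase :: "nat \<Rightarrow> nat list \<Rightarrow> gate list" where
  "parity_phase p qs = map (\<lambda>q. CNOT q p) qs @ [Tg p] @ map (\<lambda>q. CNOT q p) qs"

lemma pulls_CNOTs_to:
  "p \<notin> set qs \<Longrightarrow> pulls (map (\<lambda>q. CNOT q p) qs) R y = R (y(p := (y p \<noteq> par qs y)))"
proof (induction qs arbitrary: y)
  case (Cons q qs)
  have "par qs (y(p := (y p \<noteq> y q))) = par qs y" using Cons.prems by (intro par_cong) auto
  then show ?case using Cons by (auto intro!: arg_cong[of _ _ R])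
qed simp

text \<open>As p is not in \<open>qs\<close>, the parity is the same before and after the T gate;
  the second fan of CNOTs undoes the first and only a phase is left.\<close>

lemma pulls_parity_phase:
  assumes "p \<notin> set qs"
  shows "pulls (parity_phase p qs) R y = (if y p \<noteq> par qs y then \<omega> else 1) * R y"
proof -
  have 1: "par qs (y(p := b)) = par qs y" for b using assms by (intro par_cong) auto
  have 2: "y(p := ((y p \<noteq> par qs y) \<noteq> par qs y)) = y" by (auto simp: fun_eq_iff)
  have 3: "(y(p := b))(p := c) = y(p := c)" "(y(p := b)) p = b" for b c by simp_all
  show ?thesis
    by (simp only: parity_phase_def pulls_append pulls.simps pull.simps pulls_CNOTs_to[OF assms] 1 2 3)
qed

lemma pulls_parity_phases:
  assumes "\<And>qs. qs \<in> set qss \<Longrightarrow> p \<notin> set qs"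
  shows "pulls (concat (map (parity_phase p) qss)) R y =
    (\<Prod>qs\<leftarrow>qss. if y p \<noteq> par qs y then \<omega> else 1) * R y"
  using assms by (induction qss) (simp_all add: pulls_append pulls_parity_phase)

text \<open>R is supported where the qubits of \<open>as\<close> read \<beta>, so each Hadamard
  keeps one of its two terms and the layer yields a single sign instead of a sum over
  branches.\<close>

lemma pulls_Hads_basis:
  assumes "distinct as" "\<And>y a. a \<in> set as \<Longrightarrow> y a \<noteq> \<beta> a \<Longrightarrow> R y = 0"
  shows "pulls (map Had as) R y =
    (\<Prod>a\<in>set as. sgn_bit (y a \<and> \<beta> a) / complex_of_real (sqrt 2)) * R (\<lambda>q. if q \<in> set as then \<beta> q else y q)"
  using assms
proof (induction as arbitrary: y)
  case (Cons a as)
  let ?z = "\<lambda>q. if q \<in> set as then \<beta> q else y q"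
  have z: "(\<lambda>q. if q \<in> set as then \<beta> q else (y(a := b)) q) = ?z(a := b)" for b
    using Cons.prems by (auto simp: fun_eq_iff)
  have P: "(\<Prod>x\<in>set as. sgn_bit ((y(a := b)) x \<and> \<beta> x) / complex_of_real (sqrt 2)) =
      (\<Prod>x\<in>set as. sgn_bit (y x \<and> \<beta> x) / complex_of_real (sqrt 2))" for b
    using Cons.prems by (intro prod.cong) auto
  have R0: "R (?z(a := (\<not> \<beta> a))) = 0" by (rule Cons.prems(2)[of a]) simp_all
  have z': "(\<lambda>q. if q \<in> set (a # as) then \<beta> q else y q) = ?z(a := \<beta> a)" by (auto simp: fun_eq_iff)
  have IH: "pulls (map Had as) R y =
      (\<Prod>a\<in>set as. sgn_bit (y a \<and> \<beta> a) / complex_of_real (sqrt 2)) * R (\<lambda>q. if q \<in> set as then \<beta> q else y q)" for y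
    proof (rule Cons.IH)
    show "R y = 0" if "a' \<in> set as" "y a' \<noteq> \<beta> a'" for y a'
      by (rule Cons.prems(2)[of a']) (use that in simp_all)
  qed (use Cons.prems(1) in simp)
  have step: "pulls (map Had (a # as)) R y =
      ((\<Prod>x\<in>set as. sgn_bit (y x \<and> \<beta> x) / complex_of_real (sqrt 2)) * R (?z(a := False)) +
       sgn_bit (y a) * ((\<Prod>x\<in>set as. sgn_bit (y x \<and> \<beta> x) / complex_of_real (sqrt 2)) * R (?z(a := True))))
       / complex_of_real (sqrt 2)"
    by (simp only: IH z P list.map pulls.simps pull.simps)
  have *: "pulls (map Had (a # as)) R y =
      sgn_bit (y a \<and> \<beta> a) / complex_of_real (sqrt 2) * (\<Prod>x\<in>set as. sgn_bit (y x \<and> \<beta> x) / complex_of_real (sqrt 2)) * R (?z(a := \<beta> a))"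
    using step R0 by (cases "\<beta> a") (simp_all add: sgn_bit_def)
  have "a \<notin> set as" using Cons.prems(1) by simp
  then show ?case unfolding z' * by simp
qed simp

definition HTH :: "nat \<Rightarrow> gate list" where "HTH q = [Had q, Tg q, Had q]"

text \<open>The bra of 0 passes through H T H along two paths, on which the T gate sees 0 or 1;
  their phases are 1 and \<omega>, and the outer Hadamard adds the sign of \<open>y q\<close> to the
  second.\<close>

lemma pulls_HTH:
  assumes "\<And>y b. G (y(q := b)) = G y"
  shows "pulls (HTH q) (\<lambda>y. of_bool (\<not> y q) * G y) y = (1 + sgn_bit (y q) * \<omega>) / 2 * G y"
proof -
  have "complex_of_real (sqrt 2) * complex_of_real (sqrt 2) = 2"
    by (simp flip: of_real_mult)
  then have 1: "x / complex_of_real (sqrt 2) / complex_of_real (sqrt 2) = x / 2" for x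
    by (simp add: divide_divide_eq_left)
  have "pulls (HTH q) (\<lambda>y. of_bool (\<not> y q) * G y) y =
     (G y + sgn_bit (y q) * \<omega> * G y) / complex_of_real (sqrt 2) / complex_of_real (sqrt 2)"
    using assms by (simp add: HTH_def add_divide_distrib sgn_bit_def)
  then show ?thesis unfolding 1 by (simp add: distrib_right add_divide_distrib)
qed

text \<open>The induction closes because G is arbitrary: the indicator at the head qubit is absorbed
  into G while the tail is processed.\<close>

lemma pulls_HTHs:
  assumes "distinct qs" "\<And>y q b. q \<in> set qs \<Longrightarrow> G (y(q := b)) = G y"
  shows "pulls (concat (map HTH qs)) (\<lambda>y. (\<Prod>q\<in>set qs. of_bool (\<not> y q)) * G y) y =
    (\<Prod>q\<in>set qs. (1 + sgn_bit (y q) * \<omega>) / 2) * G y"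
  using assms
proof (induction qs arbitrary: y G)
  case (Cons q qs)
  let ?G = "\<lambda>y. of_bool (\<not> y q) * G y"
  have "pulls (concat (map HTH qs)) (\<lambda>y. (\<Prod>q\<in>set qs. of_bool (\<not> y q)) * ?G y) =
      (\<lambda>y. (\<Prod>q\<in>set qs. (1 + sgn_bit (y q) * \<omega>) / 2) * ?G y)"
  proof (rule ext, rule Cons.IH)
    fix y :: "nat \<Rightarrow> bool" and q' b assume q': "q' \<in> set qs"
    then have "q' \<noteq> q" using Cons.prems(1) by auto
    then have "(y(q' := b)) q = y q" by simp
    moreover have "G (y(q' := b)) = G y" by (rule Cons.prems(2)) (use q' in simp)
    ultimately show "?G (y(q' := b)) = ?G y" by simp
  qed (use Cons.prems(1) in simp)
  then have "pulls (concat (map HTH (q # qs))) (\<lambda>y. (\<Prod>q\<in>set (q # qs). of_bool (\<not> y q)) * G y) y =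
     pulls (HTH q) (\<lambda>y. of_bool (\<not> y q) * ((\<Prod>q\<in>set qs. (1 + sgn_bit (y q) * \<omega>) / 2) * G y)) y"
    using Cons.prems(1) by (simp add: pulls_append mult.left_commute mult.commute mult.assoc)
  also have "\<dots> = (1 + sgn_bit (y q) * \<omega>) / 2 * ((\<Prod>q\<in>set qs. (1 + sgn_bit (y q) * \<omega>) / 2) * G y)"
  proof (rule pulls_HTH)
    fix y :: "nat \<Rightarrow> bool" and b
    have "(\<Prod>x\<in>set qs. (1 + sgn_bit ((y(q := b)) x) * \<omega>) / 2) = (\<Prod>x\<in>set qs. (1 + sgn_bit (y x) * \<omega>) / 2)"
      using Cons.prems(1) by (intro prod.cong) auto
    then show "(\<Prod>x\<in>set qs. (1 + sgn_bit ((y(q := b)) x) * \<omega>) / 2) * G (y(q := b)) =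
        (\<Prod>x\<in>set qs. (1 + sgn_bit (y x) * \<omega>) / 2) * G y"
      using Cons.prems(2)[OF list.set_intros(1), of y b] by (simp only:)
  qed
  finally have "pulls (concat (map HTH (q # qs))) (\<lambda>y. (\<Prod>q\<in>set (q # qs). of_bool (\<not> y q)) * G y) y =
      (1 + sgn_bit (y q) * \<omega>) / 2 * ((\<Prod>q\<in>set qs. (1 + sgn_bit (y q) * \<omega>) / 2) * G y)" .
  moreover have "(\<Prod>q\<in>insert q (set qs). (1 + sgn_bit (y q) * \<omega>) / 2) =
      (1 + sgn_bit (y q) * \<omega>) / 2 * (\<Prod>q\<in>set qs. (1 + sgn_bit (y q) * \<omega>) / 2)"
    using Cons.prems(1) by (intro prod.insert) auto
  ultimately show ?case by (simp only: list.set mult.assoc)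
qed simp

text \<open>No control is a target, so every CNOT reads the original value of its control and the
  layer acts simultaneously.\<close>

lemma pulls_CNOTs:
  assumes "distinct (map snd es)" "\<And>c t. (c,t) \<in> set es \<Longrightarrow> c \<notin> snd ` set es"
    and "\<And>c t. (c,t) \<in> set es \<Longrightarrow> z t \<longleftrightarrow> (y t \<noteq> y c)"
    and "\<And>q. q \<notin> snd ` set es \<Longrightarrow> z q = y q"
  shows "pulls (map (\<lambda>(c,t). CNOT c t) es) R y = R z"
  using assms
proof (induction es arbitrary: y)
  case Nil
  then have "z = y" by auto
  then show ?case by simp
next
  case (Cons e es)
  obtain c t where e: "e = (c,t)" by (cases e)
  have t: "t \<notin> snd ` set es" using Cons.prems(1) e by auto
  have "pulls (map (\<lambda>(c,t). CNOT c t) es) R (y(t := (y t \<noteq> y c))) = R z"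
  proof (rule Cons.IH)
    fix c' t' assume m: "(c',t') \<in> set es"
    then have "t' \<noteq> t" using t by force
    moreover have "c' \<noteq> t" using Cons.prems(2)[of c' t'] m e by auto
    moreover have "z t' \<longleftrightarrow> (y t' \<noteq> y c')" by (rule Cons.prems(3)) (use m in simp)
    ultimately show "z t' \<longleftrightarrow> ((y(t := (y t \<noteq> y c))) t' \<noteq> (y(t := (y t \<noteq> y c))) c')"
      by (simp only: fun_upd_apply if_False)
  next
    fix q assume q: "q \<notin> snd ` set es"
    show "z q = (y(t := (y t \<noteq> y c))) q"
    proof (cases "q = t")
      case True
      have "z t \<longleftrightarrow> (y t \<noteq> y c)" by (rule Cons.prems(3)) (use e in simp)
      then show ?thesis using True by (simp only: fun_upd_same)
    next
      case False
      have "y q = z q" by (rule Cons.prems(4)[symmetric]) (use q False e in simp)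
      then show ?thesis using False by (simp only: fun_upd_other not_False_eq_True)
    qed
  next
    show "c' \<notin> snd ` set es" if "(c', t') \<in> set es" for c' t'
      using Cons.prems(2)[of c' t'] that by simp
  qed (use Cons.prems(1) in simp)
  then show ?case using e by simp
qed

section \<open>The circuit and its amplitudes\<close>

text \<open>Data qubits are below n, qubit n is the parity ancilla; ancillas n+1+q and 2n+1+q
  implement a uniformly random X and Z on data qubit q.\<close>

definition block_circ :: "nat \<Rightarrow> nat list list \<Rightarrow> gate list" where
  "block_circ n Bs = map (\<lambda>q. CNOT q (2 * n + 1 + q)) [0..<n] @ map Had [n + 1..<3 * n + 1]
     @ map (\<lambda>q. CNOT (n + 1 + q) q) [0..<n] @ concat (map (parity_phase n) Bs)
     @ concat (map HTH [0..<n])"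

definition fiducial :: "nat \<Rightarrow> nat list list \<Rightarrow> (nat \<Rightarrow> bool) \<Rightarrow> complex" where
  "fiducial n Bs y = (\<Prod>q<n. (1 + sgn_bit (y q) * \<omega>) / 2) * (\<Prod>qs\<leftarrow>Bs. if par qs y then \<omega> else 1)"

text \<open>Data qubits and parity ancilla read 0; u and v are the readings of the two ancilla
  registers and thereby the labels of the random X and Z.\<close>

definition outcome :: "nat \<Rightarrow> nat \<Rightarrow> nat \<Rightarrow> nat \<Rightarrow> bool" where
  "outcome n u v q \<longleftrightarrow> (if q \<le> n then False else if q < 2 * n + 1 then bit u (q - (n + 1))
     else bit v (q - (2 * n + 1)))"

definition chi :: "nat \<Rightarrow> nat \<Rightarrow> nat \<Rightarrow> complex" where
  "chi n v x = (\<Prod>q<n. sgn_bit (bit v q \<and> bit x q))"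

lemma sgn_bit_False [simp]: "sgn_bit False = 1"
  by (simp add: sgn_bit_def)

text \<open>An ancilla that holds a copy of a data bit and is read after a Hadamard gives the sign
  of Z^v. An ancilla read as u has controlled a flip of its data qubit exactly when its bit of u is
  set, which is X^u. Each of the 2n Hadamards costs a factor 1/sqrt 2.\<close>

lemma pulls_block_circ:
  assumes Bs: "\<And>qs. qs \<in> set Bs \<Longrightarrow> set qs \<subseteq> {..<n}" and i: "i < 2 ^ n"
  shows "pulls (block_circ n Bs) (\<lambda>y. of_bool (\<forall>q<3 * n + 1. y q = outcome n u v q)) (bit i) =
    (1 / complex_of_real (sqrt 2)) ^ (2 * n) * chi n v i * fiducial n Bs (\<lambda>q. bit i q \<noteq> bit u q)"
proof -
  define \<beta> where "\<beta> = outcome n u v"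
  \<comment> \<open>\<open>E\<close> collects the conditions on all ancillas, the parity ancilla
    included. \<open>R1\<close> to \<open>R4\<close> are the row functional after each further
    layer, counted from the end of the circuit.\<close>
  define E :: "(nat \<Rightarrow> bool) \<Rightarrow> complex" where "E y = of_bool (\<forall>q\<in>{n..<3 * n + 1}. y q = \<beta> q)" for y
  define R1 where "R1 y = (\<Prod>q<n. (1 + sgn_bit (y q) * \<omega>) / 2) * E y" for y
  define R2 where "R2 y = (\<Prod>qs\<leftarrow>Bs. if y n \<noteq> par qs y then \<omega> else 1) * R1 y" for y
  define R3 where "R3 y = R2 (\<lambda>q. if q < n then y q \<noteq> y (n + 1 + q) else y q)" for y
  define R4 where "R4 y = (\<Prod>a\<in>{n + 1..<3 * n + 1}. sgn_bit (y a \<and> \<beta> a) / complex_of_real (sqrt 2)) *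
      R3 (\<lambda>q. if q \<in> {n + 1..<3 * n + 1} then \<beta> q else y q)" for y
  have bi: "\<not> bit i q" if "\<not> q < n" for q using i that bit_nat_less_exp by blast
  have R0: "(\<lambda>y. of_bool (\<forall>q<3 * n + 1. y q = outcome n u v q)) =
      (\<lambda>y. (\<Prod>q\<in>set [0..<n]. of_bool (\<not> y q)) * E y)"
  proof (rule ext)
    fix y :: "nat \<Rightarrow> bool"
    have "(\<forall>q<3 * n + 1. y q = outcome n u v q) \<longleftrightarrow> (\<forall>q\<in>{0..<n}. \<not> y q) \<and> (\<forall>q\<in>{n..<3 * n + 1}. y q = \<beta> q)"
      by (auto simp: \<beta>_def outcome_def)
    moreover have "(\<Prod>q\<in>{0..<n}. of_bool (\<not> y q)) = (of_bool (\<forall>q\<in>{0..<n}. \<not> y q) :: complex)"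
      by (auto simp: prod_zero_iff)
    ultimately show "of_bool (\<forall>q<3 * n + 1. y q = outcome n u v q) =
        (\<Prod>q\<in>set [0..<n]. of_bool (\<not> y q)) * E y"
      by (simp only: E_def of_bool_conj set_upt)
  qed
  have 1: "pulls (concat (map HTH [0..<n])) (\<lambda>y. of_bool (\<forall>q<3 * n + 1. y q = outcome n u v q)) = R1"
    unfolding R0 by (rule ext, subst pulls_HTHs) (auto simp: R1_def E_def atLeast0LessThan)
  have 2: "pulls (concat (map (parity_phase n) Bs)) R1 = R2"
    by (rule ext, subst pulls_parity_phases) (use Bs in \<open>auto simp: R2_def\<close>)
  have 3: "pulls (map (\<lambda>q. CNOT (n + 1 + q) q) [0..<n]) R2 y = R3 y" for y
  proof -
    have "pulls (map (\<lambda>(c,t). CNOT c t) (map (\<lambda>q. (n + 1 + q, q)) [0..<n])) R2 y = R3 y"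
      unfolding R3_def by (rule pulls_CNOTs) (auto simp: comp_def image_image)
    then show ?thesis by (simp add: comp_def)
  qed
  have R3_0: "R3 y = 0" if "a \<in> set [n + 1..<3 * n + 1]" "y a \<noteq> \<beta> a" for y a
  proof -
    have "E (\<lambda>q. if q < n then y q \<noteq> y (n + 1 + q) else y q) = 0"
      using that by (auto simp: E_def intro!: bexI[of _ a])
    then show ?thesis by (simp add: R3_def R2_def R1_def)
  qed
  have 4: "pulls (map Had [n + 1..<3 * n + 1]) R3 y = R4 y" for y
    unfolding R4_def
    using pulls_Hads_basis[OF distinct_upt R3_0, of "n + 1" "3 * n + 1"] by (simp only: set_upt)
  \<comment> \<open>Since i < 2^n, all ancillas start at 0; the copies of the data bits are all that
    the first layer changes.\<close>
  define z where "z q \<longleftrightarrow> (if 2 * n + 1 \<le> q \<and> q < 3 * n + 1 then bit i (q - (2 * n + 1)) else bit i q)" for q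
  have 5: "pulls (map (\<lambda>q. CNOT q (2 * n + 1 + q)) [0..<n]) R4 (bit i) = R4 z"
  proof -
    have "pulls (map (\<lambda>(c,t). CNOT c t) (map (\<lambda>q. (q, 2 * n + 1 + q)) [0..<n])) R4 (bit i) = R4 z"
    proof (rule pulls_CNOTs)
      show "distinct (map snd (map (\<lambda>q. (q, 2 * n + 1 + q)) [0..<n]))"
        by (auto simp: comp_def distinct_map inj_on_def)
      show "z q = bit i q" if "q \<notin> snd ` set (map (\<lambda>q. (q, 2 * n + 1 + q)) [0..<n])" for q
      proof -
        have "\<not> (2 * n + 1 \<le> q \<and> q < 3 * n + 1)"
        proof
          assume "2 * n + 1 \<le> q \<and> q < 3 * n + 1"
          then have "q = 2 * n + 1 + (q - (2 * n + 1))" "q - (2 * n + 1) \<in> {0..<n}" by auto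
          then have "q \<in> (\<lambda>q. 2 * n + 1 + q) ` {0..<n}" by blast
          then show False using that by (simp add: image_image)
        qed
        then show ?thesis unfolding z_def by (rule if_not_P)
      qed
    qed (auto simp: z_def bi)
    then show ?thesis by (simp add: comp_def)
  qed
  have "pulls (block_circ n Bs) (\<lambda>y. of_bool (\<forall>q<3 * n + 1. y q = outcome n u v q)) (bit i) = R4 z"
    unfolding block_circ_def pulls_append 1 2 3 4 5[symmetric] by simp
  also have "\<dots> = (1 / complex_of_real (sqrt 2)) ^ (2 * n) * chi n v i * fiducial n Bs (\<lambda>q. bit i q \<noteq> bit u q)"
  proof -
    have "(\<Prod>a\<in>{n + 1..<3 * n + 1}. sgn_bit (z a \<and> \<beta> a) / complex_of_real (sqrt 2)) =
        (1 / complex_of_real (sqrt 2)) ^ (2 * n) * (\<Prod>a\<in>{n + 1..<3 * n + 1}. sgn_bit (z a \<and> \<beta> a))"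
      by (simp add: prod_dividef power_one_over field_simps)
    \<comment> \<open>The ancillas of the X register still hold 0 when their Hadamard acts, so they
      contribute no sign.\<close>
    also have "(\<Prod>a\<in>{n + 1..<3 * n + 1}. sgn_bit (z a \<and> \<beta> a)) = (\<Prod>a\<in>{2 * n + 1..<3 * n + 1}. sgn_bit (z a \<and> \<beta> a))"
      by (rule prod.mono_neutral_right) (auto simp: z_def bi)
    also have "\<dots> = chi n v i"
      unfolding chi_def
      by (rule prod.reindex_bij_witness[of _ "\<lambda>q. 2 * n + 1 + q" "\<lambda>a. a - (2 * n + 1)"])
        (auto simp: z_def \<beta>_def outcome_def conj_commute)
    finally have P: "(\<Prod>a\<in>{n + 1..<3 * n + 1}. sgn_bit (z a \<and> \<beta> a) / complex_of_real (sqrt 2)) =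
      (1 / complex_of_real (sqrt 2)) ^ (2 * n) * chi n v i" .
    define w where "w q \<longleftrightarrow> (if q \<in> {n + 1..<3 * n + 1} then \<beta> q else z q)" for q
    define w' where "w' q \<longleftrightarrow> (if q < n then w q \<noteq> w (n + 1 + q) else w q)" for q
    have wq: "w' q \<longleftrightarrow> bit i q \<noteq> bit u q" if "q < n" for q
      using that by (simp add: w'_def w_def z_def \<beta>_def outcome_def)
    have wn: "\<not> w' n" by (simp add: w'_def w_def z_def bi)
    have "E w' = 1" using bi by (auto simp: E_def w'_def w_def z_def \<beta>_def outcome_def)
    moreover have "par qs w' = par qs (\<lambda>q. bit i q \<noteq> bit u q)" if "qs \<in> set Bs" for qs
      using Bs[OF that] wq by (intro par_cong) auto
    then have "(\<Prod>qs\<leftarrow>Bs. if w' n \<noteq> par qs w' then \<omega> else 1) =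
        (\<Prod>qs\<leftarrow>Bs. if par qs (\<lambda>q. bit i q \<noteq> bit u q) then \<omega> else 1)"
      using wn by (intro arg_cong[of _ _ prod_list] map_cong) auto
    moreover have "(\<Prod>q<n. (1 + sgn_bit (w' q) * \<omega>) / 2) = (\<Prod>q<n. (1 + sgn_bit (bit i q \<noteq> bit u q) * \<omega>) / 2)"
      by (intro prod.cong) (auto simp: wq)
    ultimately have "R2 w' = fiducial n Bs (\<lambda>q. bit i q \<noteq> bit u q)"
      by (simp only: R2_def R1_def fiducial_def mult_1_right mult.commute[of "prod_list _"])
    moreover have "R3 (\<lambda>q. if q \<in> {n + 1..<3 * n + 1} then \<beta> q else z q) = R2 w'"
      unfolding R3_def w'_def w_def ..
    ultimately show ?thesis unfolding R4_def P by simp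
  qed
  finally show ?thesis .
qed

section \<open>The computational basis as stabilizer data\<close>

definition Z_paulis :: "nat \<Rightarrow> pauli list" where
  "Z_paulis k = map (\<lambda>j. (0, \<lambda>q. if q = j then 3 else 0)) [0..<k]"

lemma pauli_mat_Z:
  assumes "j < k"
  shows "pauli_mat k (0, \<lambda>q. if q = j then 3 else 0) =
    mat (2 ^ k) (2 ^ k) (\<lambda>(x,y). if x = y then sgn_bit (bit x j) else 0)"
proof (rule eq_matI, goal_cases)
  case (1 x y)
  then have xy: "x < 2 ^ k" "y < 2 ^ k" by auto
  have "(\<Prod>q<k. pauli1 (if q = j then 3 else 0) (qbit x q) (qbit y q)) =
      (if x = y then sgn_bit (bit x j) else 0)"
  proof (cases "x = y")
    case True
    have "(\<Prod>q<k. pauli1 (if q = j then 3 else 0) (qbit x q) (qbit y q)) =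
        (\<Prod>q<k. if q = j then sgn_bit (bit x j) else 1)"
      using True by (intro prod.cong) (auto simp: pauli1_def qbit_eq_of_bool_bit sgn_bit_def)
    then show ?thesis using True assms by simp
  next
    case False
    then obtain q where "q < k" "bit x q \<noteq> bit y q" using nat_eq_if_bits_eq xy by blast
    then have "\<exists>q\<in>{..<k}. pauli1 (if q = j then 3 else 0) (qbit x q) (qbit y q) = 0"
      by (auto simp: pauli1_def qbit_eq_of_bool_bit intro!: bexI[of _ q])
    then have "(\<Prod>q<k. pauli1 (if q = j then 3 else 0) (qbit x q) (qbit y q)) = 0"
      by (intro prod_zero) auto
    then show ?thesis using False by simp
  qed
  then show ?case using xy by (simp add: pauli_mat_def)
qed (auto simp: pauli_mat_def)

lemma Z_mult_unit_vec:
  assumes "j < k" "b < 2 ^ k"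
  shows "pauli_mat k (0, \<lambda>q. if q = j then 3 else 0) *\<^sub>v unit_vec (2 ^ k) b = sgn_bit (bit b j) \<cdot>\<^sub>v unit_vec (2 ^ k) b"
  unfolding pauli_mat_Z[OF assms(1)]
  using assms(2) by (intro eq_vecI) (auto simp: mult_mat_vec_def scalar_prod_def unit_vec_def if_distrib cong: if_cong)

lemma good_Z_paulis: "good_paulis k (Z_paulis k)"
  unfolding good_paulis_def
proof (intro conjI)
  show "independent_paulis k (Z_paulis k)"
    unfolding independent_paulis_def
  proof (intro allI impI)
    fix S assume S: "S \<subseteq> {..<length (Z_paulis k)}" "S \<noteq> {}"
    then obtain i where i: "i \<in> S" "i < k" by (auto simp: Z_paulis_def)
    \<comment> \<open>Generator i alone acts on qubit i, so this qubit sees an odd number, namely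
      one, of Z parts.\<close>
    have "{i' \<in> S. zpart (snd (Z_paulis k ! i') i)} = {i}"
      using S i by (auto simp: Z_paulis_def zpart_def split: if_splits)
    then show "\<exists>q<k. odd (card {i \<in> S. xpart (snd (Z_paulis k ! i) q)}) \<or> odd (card {i \<in> S. zpart (snd (Z_paulis k ! i) q)})"
      using i by (intro exI[of _ i]) simp
  qed
  show "commuting_paulis k (Z_paulis k)"
    unfolding commuting_paulis_def
  proof (intro ballI)
    fix P Q assume "P \<in> set (Z_paulis k)" "Q \<in> set (Z_paulis k)"
    then obtain i j where ij: "i < k" "j < k" "P = (0, \<lambda>q. if q = i then 3 else 0)" "Q = (0, \<lambda>q. if q = j then 3 else 0)"
      by (auto simp: Z_paulis_def)
    show "pauli_mat k P * pauli_mat k Q = pauli_mat k Q * pauli_mat k P"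
      unfolding ij(3,4) pauli_mat_Z[OF ij(1)] pauli_mat_Z[OF ij(2)]
      by (intro eq_matI) (auto simp: scalar_prod_def intro!: sum.cong)
  qed
qed (auto simp: Z_paulis_def valid_pauli_def)

lemma cinner_unit_vec:
  assumes "b < d" "c < d"
  shows "cinner (unit_vec d b) (unit_vec d c) = (if b = c then 1 else 0)"
proof -
  have "cinner (unit_vec d b) (unit_vec d c) = (\<Sum>i<d. if i = b then of_bool (b = c) else 0)"
    unfolding cinner_def index_unit_vec(3) by (rule sum.cong) (use assms in auto)
  then show ?thesis using assms by simp
qed

lemma stabilizer_state_unit_vec: "stabilizer_state m (unit_vec (2 ^ m) 0)"
  unfolding stabilizer_state_def
proof (intro conjI exI)
  show "\<forall>P\<in>set (Z_paulis m). pauli_mat m P *\<^sub>v unit_vec (2 ^ m) 0 = unit_vec (2 ^ m) 0"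
    by (auto simp: Z_paulis_def Z_mult_unit_vec)
qed (auto simp: good_Z_paulis cinner_unit_vec)

lemma stabilizer_basis_unit_vec: "stabilizer_basis k (unit_vec (2 ^ k))"
  unfolding stabilizer_basis_def
proof (intro exI conjI)
  show "good_paulis k (Z_paulis k)" by (rule good_Z_paulis)
  show "\<forall>b<2 ^ k. dim_vec (unit_vec (2 ^ k) b) = 2 ^ k \<and>
      (\<forall>P\<in>set (Z_paulis k). \<exists>ev. pauli_mat k P *\<^sub>v unit_vec (2 ^ k) b = ev \<cdot>\<^sub>v unit_vec (2 ^ k) b)"
    using Z_mult_unit_vec by (fastforce simp: Z_paulis_def)
qed (auto simp: cinner_unit_vec)

lemma index_mult_mat_sum:
  assumes "A \<in> carrier_mat m d" "B \<in> carrier_mat d n" "i < m" "j < n"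
  shows "(A * B) $$ (i, j) = (\<Sum>y\<in>{0..<d}. A $$ (i, y) * B $$ (y, j))"
  using assms by (simp add: scalar_prod_def)

text \<open>With the ancillas in state 0, data state i keeps the index i in the larger space. Hence
  \<open>embed\<close> is the inclusion of the first 2^n indices, and the element is the rank-one
  operator built from row b of U.\<close>

lemma povm_elem_unit_vec:
  assumes U: "U \<in> carrier_mat (2 ^ (n + m)) (2 ^ (n + m))" and b: "b < 2 ^ (n + m)"
    and ij: "i < 2 ^ n" "j < 2 ^ n"
  shows "povm_elem n m (unit_vec (2 ^ m) 0) U (unit_vec (2 ^ (n + m)) b) $$ (i, j) = cnj (U $$ (b, i)) * U $$ (b, j)"
proof -
  let ?N = "2 ^ (n + m) :: nat"
  let ?E = "embed n m (unit_vec (2 ^ m) 0)"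
  let ?O = "outer (unit_vec ?N b)"
  have E: "?E \<in> carrier_mat ?N (2 ^ n)" by (simp add: embed_def)
  have O: "?O \<in> carrier_mat ?N ?N" by (simp add: outer_def)
  have N: "2 ^ n \<le> ?N" by simp
  have En: "?E $$ (x, j) = of_bool (x = j)" if "x < ?N" "j < 2 ^ n" for x j
  proof -
    have "x div 2 ^ n < 2 ^ m" using that by (simp add: less_mult_imp_div_less power_add mult.commute)
    then show ?thesis using that
      by (auto simp: embed_def unit_vec_def div_eq_0_iff)
  qed
  have UE: "(U * ?E) $$ (x, j) = U $$ (x, j)" if "x < ?N" "j < 2 ^ n" for x j
  proof -
    have "(U * ?E) $$ (x, j) = (\<Sum>y\<in>{0..<?N}. U $$ (x, y) * ?E $$ (y, j))"
      using that by (intro index_mult_mat_sum[OF U E])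
    also have "\<dots> = (\<Sum>y\<in>{0..<?N}. if y = j then U $$ (x, j) else 0)"
      using that by (intro sum.cong) (auto simp: En)
    also have "\<dots> = U $$ (x, j)" using that less_le_trans[OF that(2) N] by simp
    finally show ?thesis .
  qed
  define W where "W = U * ?E"
  have W: "W \<in> carrier_mat ?N (2 ^ n)" using U E by (simp add: W_def)
  have adj: "cadj ?E * cadj U = cadj W"
    unfolding W_def using U E by (intro eq_matI) (auto simp: cadj_def scalar_prod_def cnj_sum mult.commute intro!: sum.cong)
  have cW: "cadj W \<in> carrier_mat (2 ^ n) ?N"
    using W by (auto simp: cadj_def)
  have povm: "povm_elem n m (unit_vec (2 ^ m) 0) U (unit_vec ?N b) = cadj W * ?O * W"
    unfolding povm_elem_def adj using assoc_mult_mat[OF mult_carrier_mat[OF cW O] U E] by (simp only: W_def)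
  have OW: "(?O * W) $$ (x, j) = (if x = b then W $$ (b, j) else 0)" if "x < ?N" for x
  proof -
    have "(?O * W) $$ (x, j) = (\<Sum>y\<in>{0..<?N}. ?O $$ (x, y) * W $$ (y, j))"
      using that ij by (intro index_mult_mat_sum[OF O W])
    also have "\<dots> = (\<Sum>y\<in>{0..<?N}. if y = b then (if x = b then W $$ (b, j) else 0) else 0)"
      using that by (intro sum.cong) (auto simp: outer_def unit_vec_def)
    also have "\<dots> = (if x = b then W $$ (b, j) else 0)" using b by simp
    finally show ?thesis .
  qed
  have "(cadj W * (?O * W)) $$ (i, j) = (\<Sum>x\<in>{0..<?N}. cadj W $$ (i, x) * (?O * W) $$ (x, j))"
    by (rule index_mult_mat_sum[OF cW mult_carrier_mat[OF O W] ij])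
  also have "\<dots> = (\<Sum>x\<in>{0..<?N}. if x = b then cadj W $$ (i, b) * W $$ (b, j) else 0)"
  proof (intro sum.cong refl)
    fix x assume "x \<in> {0..<?N}"
    then have x: "x < ?N" by simp
    show "cadj W $$ (i, x) * (?O * W) $$ (x, j) = (if x = b then cadj W $$ (i, b) * W $$ (b, j) else 0)"
      unfolding OW[OF x] by (cases "x = b") simp_all
  qed
  also have "\<dots> = cadj W $$ (i, b) * W $$ (b, j)" using b by simp
  finally have "(cadj W * (?O * W)) $$ (i, j) = cadj W $$ (i, b) * W $$ (b, j)" .
  moreover have "cadj W * ?O * W = cadj W * (?O * W)" by (rule assoc_mult_mat[OF cW O W])
  moreover have "cadj W $$ (i, b) = cnj (W $$ (b, i))" using W b ij unfolding cadj_def by simp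
  moreover have "W $$ (b, i) = U $$ (b, i)" "W $$ (b, j) = U $$ (b, j)"
    unfolding W_def using UE b ij by blast+
  ultimately show ?thesis by (simp only: povm)
qed

section \<open>Fourier analysis of the measurement operators\<close>

lemma sum_prod_bits:
  "(\<Sum>u<(2::nat) ^ n. \<Prod>q<n. F q (bit u q)) = (\<Prod>q<n. F q False + F q True)"
  for F :: "nat \<Rightarrow> bool \<Rightarrow> complex"
proof -
  have "(\<Sum>u<(2::nat) ^ n. \<Prod>q<n. F q (bit u q)) = (\<Sum>g\<in>PiE {..<n} (\<lambda>_. UNIV). \<Prod>q<n. F q (g q))"
  proof (rule sum.reindex_bij_witness[of _ "of_bits n" "\<lambda>u. restrict (bit u) {..<n}"])
    show "of_bits n (restrict (bit u) {..<n}) = u" if "u \<in> {..<2 ^ n}" for u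
      by (rule nat_eq_if_bits_eq[of _ n]) (use that in \<open>simp_all add: of_bits_less bit_of_bits\<close>)
    show "restrict (bit (of_bits n g)) {..<n} = g" if "g \<in> PiE {..<n} (\<lambda>_. UNIV)" for g
      by (rule ext) (use that in \<open>auto simp: bit_of_bits restrict_def PiE_def extensional_def\<close>)
    show "(\<Prod>q<n. F q (restrict (bit u) {..<n} q)) = (\<Prod>q<n. F q (bit u q))" for u :: nat
      by (intro prod.cong) auto
  qed (auto simp: of_bits_less)
  also have "\<dots> = (\<Prod>q<n. \<Sum>b\<in>UNIV. F q b)"
    by (rule prod_sum_PiE[symmetric]) auto
  finally show ?thesis by (simp add: UNIV_bool)
qed

lemma xor_nat_less:
  assumes "i < 2 ^ n" "u < 2 ^ n"
  shows "(i XOR u :: nat) < 2 ^ n"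
proof -
  have "i XOR u = of_bits n (bit (i XOR u))"
    using assms by (intro bit_eqI) (auto simp: bit_of_bits bit_xor_iff dest: bit_nat_less_exp)
  then show ?thesis using of_bits_less by metis
qed

lemma xor_xor_nat [simp]: "i XOR (i XOR u) = (u::nat)"
  by (rule bit_eqI) (auto simp: bit_xor_iff)

lemma sum_xor:
  assumes "i < 2 ^ n"
  shows "(\<Sum>u<2 ^ n. h (i XOR u)) = (\<Sum>u<2 ^ n. h (u::nat))"
  by (rule sum.reindex_bij_witness[of _ "\<lambda>u. i XOR u" "\<lambda>u. i XOR u"]) (use assms in \<open>auto simp: xor_nat_less\<close>)

lemma chi_commute: "chi n v x = chi n x v"
  by (simp add: chi_def conj_commute)

lemma chi_xor: "chi n v (x XOR y) = chi n v x * chi n v y"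
  unfolding chi_def prod.distrib[symmetric]
  by (intro prod.cong) (auto simp: sgn_bit_def bit_xor_iff)

lemma cnj_chi [simp]: "cnj (chi n v x) = chi n v x"
  unfolding chi_def by (auto simp: sgn_bit_def intro!: prod.cong)

lemma sum_chi:
  assumes "x < 2 ^ n" "y < 2 ^ n"
  shows "(\<Sum>v<2 ^ n. chi n x v * chi n y v) = (if x = y then 2 ^ n else 0)"
proof -
  have "(\<Sum>v<2 ^ n. chi n x v * chi n y v) =
      (\<Sum>v<(2::nat) ^ n. \<Prod>q<n. sgn_bit (bit x q \<and> bit v q) * sgn_bit (bit y q \<and> bit v q))"
    by (simp add: chi_def prod.distrib)
  also have "\<dots> = (\<Prod>q<n. if bit x q = bit y q then 2 else 0)"
    unfolding sum_prod_bits[where n = n and F = "\<lambda>q b. sgn_bit (bit x q \<and> b) * sgn_bit (bit y q \<and> b)"]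
    by (intro prod.cong) (auto simp: sgn_bit_def)
  also have "\<dots> = (if x = y then 2 ^ n else 0)"
  proof (cases "x = y")
    case False
    then obtain q where "q < n" "bit x q \<noteq> bit y q" using nat_eq_if_bits_eq assms by blast
    then show ?thesis using False by (auto intro!: prod_zero bexI[of _ q])
  qed simp
  finally show ?thesis .
qed

text \<open>The matrix of Z^z X^x. Omitting the factor i of Y keeps the entries real, so the
  bilinear pairing of each such matrix with itself is 2^n.\<close>

definition pauli_fun :: "nat \<Rightarrow> nat \<times> nat \<Rightarrow> nat \<times> nat \<Rightarrow> complex" where
  "pauli_fun n = (\<lambda>(x,z) (i,j). if i XOR j = x then chi n z i else 0)"

lemma pauli_fun_orthogonal:
  assumes "x < 2 ^ n" "z < 2 ^ n" "x' < 2 ^ n" "z' < 2 ^ n"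
  shows "(\<Sum>p\<in>{..<2 ^ n} \<times> {..<2 ^ n}. pauli_fun n (x,z) p * pauli_fun n (x',z') p) =
    (if (x,z) = (x',z') then 2 ^ n else 0)"
proof -
  have row: "(\<Sum>j<2 ^ n. pauli_fun n (x,z) (i,j) * pauli_fun n (x',z') (i,j)) =
      (if x = x' then chi n z i * chi n z' i else 0)" if "i < 2 ^ n" for i
  proof -
    have "(\<Sum>j<2 ^ n. pauli_fun n (x,z) (i,j) * pauli_fun n (x',z') (i,j)) =
        (\<Sum>j<2 ^ n. if i XOR j = x then if x = x' then chi n z i * chi n z' i else 0 else 0)"
      by (intro sum.cong) (auto simp: pauli_fun_def)
    also have "\<dots> = (\<Sum>j<2 ^ n. if j = x then if x = x' then chi n z i * chi n z' i else 0 else 0)"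
      by (rule sum_xor[OF that, of "\<lambda>j. if j = x then if x = x' then chi n z i * chi n z' i else 0 else 0"])
    also have "\<dots> = (if x = x' then chi n z i * chi n z' i else 0)" using assms by simp
    finally show ?thesis .
  qed
  have "(\<Sum>p\<in>{..<2 ^ n} \<times> {..<2 ^ n}. pauli_fun n (x,z) p * pauli_fun n (x',z') p) =
      (\<Sum>i<2 ^ n. \<Sum>j<2 ^ n. pauli_fun n (x,z) (i,j) * pauli_fun n (x',z') (i,j))"
    by (simp add: sum.cartesian_product)
  also have "\<dots> = (\<Sum>i<2 ^ n. if x = x' then chi n z i * chi n z' i else 0)"
    by (intro sum.cong) (auto simp: row)
  also have "\<dots> = (if (x,z) = (x',z') then 2 ^ n else 0)"
    using sum_chi[OF assms(2,4)] by (cases "x = x'") simp_all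
  finally show ?thesis .
qed

text \<open>This is the expectation <F| Z^z X^x |F> of the fiducial vector F.\<close>

definition correlation :: "nat \<Rightarrow> nat list list \<Rightarrow> nat \<Rightarrow> nat \<Rightarrow> complex" where
  "correlation n Bs x z =
    (\<Sum>u<2 ^ n. chi n z u * (cnj (fiducial n Bs (bit u)) * fiducial n Bs (bit (x XOR u))))"

definition povm_amp :: "nat \<Rightarrow> nat list list \<Rightarrow> nat \<Rightarrow> nat \<Rightarrow> nat \<Rightarrow> complex" where
  "povm_amp n Bs u v i = (1 / complex_of_real (sqrt 2)) ^ (2 * n) * chi n v i * fiducial n Bs (bit (i XOR u))"

text \<open>Fourier inversion in both labels: the sum over v selects the entries with
  \<open>i XOR j = x\<close>, and the sum over u yields \<open>chi n z i\<close> times the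
  correlation. The squared amplitude brings 4^(-n), offset by 2^n from the sum over v and the
  explicit 2^n in the coefficient.\<close>

lemma pauli_fun_decomposition:
  assumes "x < 2 ^ n" "z < 2 ^ n" "i < 2 ^ n" "j < 2 ^ n" "correlation n Bs x z \<noteq> 0"
  shows "pauli_fun n (x,z) (i,j) =
    (\<Sum>(u,v)\<in>{..<2 ^ n} \<times> {..<2 ^ n}. chi n v x * chi n z u * 2 ^ n / correlation n Bs x z *
      (cnj (povm_amp n Bs u v i) * povm_amp n Bs u v j))"
proof -
  let ?F = "\<lambda>u. fiducial n Bs (bit u)" and ?c = "correlation n Bs x z"
  let ?C = "(1 / complex_of_real (sqrt 2)) ^ (2 * n)"
  have C: "cnj ?C * ?C * (2 ^ n * 2 ^ n) = 1"
  proof -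
    have "cnj ?C = ?C" by simp
    moreover have "?C = 1 / 2 ^ n"
      by (simp add: power_mult power_divide power2_eq_square flip: of_real_mult)
    ultimately show ?thesis by simp
  qed
  have V: "(\<Sum>v<2 ^ n. chi n v x * (chi n v i * chi n v j)) = (if i XOR j = x then 2 ^ n else 0)"
  proof -
    have "(\<Sum>v<2 ^ n. chi n v x * (chi n v i * chi n v j)) = (\<Sum>v<2 ^ n. chi n x v * chi n (i XOR j) v)"
      by (intro sum.cong) (auto simp: chi_xor[symmetric] chi_commute)
    also have "\<dots> = (if x = i XOR j then 2 ^ n else 0)"
      using assms by (intro sum_chi xor_nat_less)
    finally show ?thesis by auto
  qed
  have U: "(\<Sum>u<2 ^ n. chi n z u * (cnj (?F (i XOR u)) * ?F (j XOR u))) = chi n z i * ?c" if "i XOR j = x"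
  proof -
    \<comment> \<open>With w = \<open>i XOR u\<close> the two arguments become w and
      \<open>x XOR w\<close>, the shape of the correlation; translating the sum by i then costs only
      the sign \<open>chi n z i\<close>.\<close>
    have j: "j XOR u = x XOR (i XOR u)" for u
      unfolding that[symmetric] by (rule bit_eqI) (auto simp: bit_xor_iff)
    have "(\<Sum>u<2 ^ n. chi n z u * (cnj (?F (i XOR u)) * ?F (j XOR u))) =
        (\<Sum>u<2 ^ n. chi n z (i XOR (i XOR u)) * (cnj (?F (i XOR u)) * ?F (x XOR (i XOR u))))"
      by (simp add: j)
    also have "\<dots> = (\<Sum>u<2 ^ n. chi n z (i XOR u) * (cnj (?F u) * ?F (x XOR u)))"
      by (rule sum_xor[OF assms(3), of "\<lambda>w. chi n z (i XOR w) * (cnj (?F w) * ?F (x XOR w))"])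
    also have "\<dots> = chi n z i * ?c"
      by (simp add: correlation_def chi_xor sum_distrib_left mult.assoc)
    finally show ?thesis .
  qed
  have "(\<Sum>(u,v)\<in>{..<2 ^ n} \<times> {..<2 ^ n}. chi n v x * chi n z u * 2 ^ n / ?c *
      (cnj (povm_amp n Bs u v i) * povm_amp n Bs u v j)) =
    (\<Sum>u<2 ^ n. \<Sum>v<2 ^ n. cnj ?C * ?C * 2 ^ n / ?c * (chi n z u * (cnj (?F (i XOR u)) * ?F (j XOR u))) *
      (chi n v x * (chi n v i * chi n v j)))"
    unfolding sum.cartesian_product by (intro sum.cong) (auto simp: povm_amp_def)
  also have "\<dots> = cnj ?C * ?C * 2 ^ n / ?c * (\<Sum>u<2 ^ n. chi n z u * (cnj (?F (i XOR u)) * ?F (j XOR u))) *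
      (\<Sum>v<2 ^ n. chi n v x * (chi n v i * chi n v j))"
    by (simp only: sum_distrib_left[symmetric] sum_distrib_right[symmetric])
  also have "\<dots> = pauli_fun n (x,z) (i,j)"
  proof (cases "i XOR j = x")
    case True
    have "cnj ?C * ?C * 2 ^ n / ?c * (chi n z i * ?c) * 2 ^ n = cnj ?C * ?C * (2 ^ n * 2 ^ n) * chi n z i"
      using assms(5) by (simp add: field_simps)
    then show ?thesis unfolding V U[OF True] using True by (simp only: C pauli_fun_def if_True prod.case mult_1_left simp_thms)
  next
    case False
    then show ?thesis unfolding V by (simp add: pauli_fun_def)
  qed
  finally show ?thesis by simp
qed

section \<open>Pauli support of the block construction\<close>

definition blocks :: "nat \<Rightarrow> nat \<Rightarrow> nat list list" where
  "blocks n l = map (\<lambda>j. filter (\<lambda>q. q mod l = j) [0..<n]) [0..<l]"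

abbreviation block :: "nat \<Rightarrow> nat \<Rightarrow> nat \<Rightarrow> nat set" where
  "block n l j \<equiv> {q \<in> {..<n}. q mod l = j}"

text \<open>The label (True, False) stands for X, (True, True) for Y, (False, True) for Z.\<close>

definition block_good :: "nat set \<Rightarrow> (nat \<Rightarrow> bool \<times> bool) \<Rightarrow> bool" where
  "block_good I h \<longleftrightarrow> (\<forall>q\<in>I. h q \<noteq> (True, False)) \<or>
    odd (card {q\<in>I. fst (h q)}) \<and> (\<forall>q\<in>I. h q \<noteq> (True, True))"

lemma par_iff_odd_card: "distinct qs \<Longrightarrow> par qs y \<longleftrightarrow> odd (card {q\<in>set qs. y q})"
proof (induction qs)
  case (Cons q qs)
  have "{p \<in> set (q # qs). y p} = (if y q then insert q {p \<in> set qs. y p} else {p \<in> set qs. y p})" by auto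
  then show ?case using Cons by auto
qed simp

text \<open>The expectation of Z^z X^x in the single-qubit vector with amplitudes (1 + \<omega>)/2
  and (1 - \<omega>)/2.\<close>

definition qubit_factor :: "bool \<Rightarrow> bool \<Rightarrow> complex" where
  "qubit_factor x z = cnj ((1 + \<omega>) / 2) * ((1 + sgn_bit x * \<omega>) / 2)
     + sgn_bit z * (cnj ((1 - \<omega>) / 2) * ((1 + sgn_bit (\<not> x) * \<omega>) / 2))"

lemma omega_eq: "\<omega> = (1 + \<i>) / complex_of_real (sqrt 2)"
  by (simp add: \<omega>_def cis.ctr complex_eq_iff cos_45 sin_45 real_div_sqrt field_simps)

lemma cnj_omega_mult: "cnj \<omega> * \<omega> = 1"
  by (simp add: \<omega>_def cis_cnj cis_mult)

text \<open>For X the value is half the real part of (1 + cnj \<omega>)(1 - \<omega>) = cnj \<omega>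
  - \<omega>, which is purely imaginary. For Y the sign of z keeps the imaginary part
  instead.\<close>

lemma qubit_factor_eq_0_iff: "qubit_factor x z = 0 \<longleftrightarrow> x \<and> \<not> z"
proof -
  have sq: "Re \<omega> = 1 / sqrt 2" "Im \<omega> = 1 / sqrt 2" by (simp_all add: omega_eq Re_divide_of_real Im_divide_of_real)
  have s2: "1 / sqrt 2 * (1 / sqrt 2) = (1 / 2 :: real)" by simp
  show ?thesis
    by (cases x; cases z)
      (simp_all add: qubit_factor_def sgn_bit_def complex_eq_iff sq s2 field_simps)
qed

text \<open>For odd s the product is \<omega> or its conjugate, depending on p. Writing both as one
  affine expression in \<open>sgn_bit p\<close> allows the product over blocks to be multiplied
  out.\<close>

lemma cnj_phase_mult:
  "cnj (if p then \<omega> else 1) * (if p \<noteq> s then \<omega> else 1) =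
    (if s then 1 / complex_of_real (sqrt 2) * (\<i> * sgn_bit p + 1) else 1)"
proof (cases s)
  case True
  have "cnj \<omega> = 1 / complex_of_real (sqrt 2) * (- \<i> + 1)" "\<omega> = 1 / complex_of_real (sqrt 2) * (\<i> + 1)"
    by (simp_all add: omega_eq)
  then show ?thesis using True by (cases p) (simp_all add: sgn_bit_def)
qed (simp add: cnj_omega_mult)

lemma set_block: "set (filter (\<lambda>q. q mod l = j) [0..<n]) = block n l j"
  by auto

lemma fiducial_blocks:
  "fiducial n (blocks n l) y = (\<Prod>q<n. (1 + sgn_bit (y q) * \<omega>) / 2) *
    (\<Prod>j<l. if par (filter (\<lambda>q. q mod l = j) [0..<n]) y then \<omega> else 1)"
  by (simp add: fiducial_def blocks_def comp_def prod.distinct_set_conv_list[symmetric] atLeast0LessThan)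

lemma par_xor: "par qs (\<lambda>q. x q \<noteq> y q) \<longleftrightarrow> par qs x \<noteq> par qs y"
  by (induction qs) auto

text \<open>K is the set of odd blocks in which the summand with \<open>sgn_bit\<close> is chosen.
  That sign is Z on the whole block, so it merely flips the z labels there, and the sum over u then
  factorises over the qubits.\<close>

lemma correlation_expansion:
  fixes n l x z :: nat
  assumes "0 < l"
  defines "J \<equiv> {j. j < l \<and> odd (card {q \<in> block n l j. bit x q})}"
  shows "correlation n (blocks n l) x z =
    (\<Prod>j\<in>J. 1 / complex_of_real (sqrt 2)) *
    (\<Sum>K\<in>Pow J. \<i> ^ card K * (\<Prod>q<n. qubit_factor (bit x q) (bit z q \<noteq> (q mod l \<in> K))))"
proof -
  let ?P = "\<lambda>j. par (filter (\<lambda>q. q mod l = j) [0..<n])"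
  let ?s = "\<lambda>b. (1 + sgn_bit b * \<omega>) / 2"
  have J: "j < l \<Longrightarrow> ?P j (bit x) \<longleftrightarrow> j \<in> J" for j
    by (simp add: J_def par_iff_odd_card set_block del: set_filter)
  have finJ: "finite J" by (simp add: J_def)
  have phase: "cnj (\<Prod>j<l. if ?P j (bit u) then \<omega> else 1) * (\<Prod>j<l. if ?P j (bit (x XOR u)) then \<omega> else 1) =
      (\<Prod>j\<in>J. 1 / complex_of_real (sqrt 2)) *
      (\<Sum>K\<in>Pow J. \<i> ^ card K * (\<Prod>q<n. if q mod l \<in> K then sgn_bit (bit u q) else 1))" for u :: nat
  proof -
    have X: "bit (x XOR u) = (\<lambda>q. bit x q \<noteq> bit u q)" by (simp add: fun_eq_iff bit_xor_iff)
    have "cnj (\<Prod>j<l. if ?P j (bit u) then \<omega> else 1) * (\<Prod>j<l. if ?P j (bit (x XOR u)) then \<omega> else 1) =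
        (\<Prod>j<l. cnj (if ?P j (bit u) then \<omega> else 1) * (if ?P j (bit u) \<noteq> ?P j (bit x) then \<omega> else 1))"
      unfolding X par_xor prod.distrib cnj_prod by (intro arg_cong2[of _ _ _ _ "(*)"] prod.cong) auto
    also have "\<dots> = (\<Prod>j<l. if j \<in> J then 1 / complex_of_real (sqrt 2) * (\<i> * sgn_bit (?P j (bit u)) + 1) else 1)"
      unfolding cnj_phase_mult by (intro prod.cong) (auto simp: J)
    also have "\<dots> = (\<Prod>j\<in>J. 1 / complex_of_real (sqrt 2) * (\<i> * sgn_bit (?P j (bit u)) + 1))"
      by (intro prod.mono_neutral_cong_right) (auto simp: J_def)
    also have "\<dots> = (\<Prod>j\<in>J. 1 / complex_of_real (sqrt 2)) * (\<Prod>j\<in>J. \<i> * sgn_bit (?P j (bit u)) + 1)"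
      by (rule prod.distrib)
    also have "(\<Prod>j\<in>J. \<i> * sgn_bit (?P j (bit u)) + 1) =
        (\<Sum>K\<in>Pow J. (\<Prod>j\<in>K. \<i> * sgn_bit (?P j (bit u))) * (\<Prod>j\<in>J - K. 1))"
      by (rule prod_add[OF finJ])
    also have "\<dots> = (\<Sum>K\<in>Pow J. \<i> ^ card K * (\<Prod>q<n. if q mod l \<in> K then sgn_bit (bit u q) else 1))"
    proof (intro sum.cong refl)
      fix K assume "K \<in> Pow J"
      then have K: "finite K" "K \<subseteq> J" using finJ finite_subset by auto
      have "(\<Prod>j\<in>K. sgn_bit (?P j (bit u))) = (\<Prod>j\<in>K. \<Prod>q\<in>{q \<in> {q \<in> {..<n}. q mod l \<in> K}. q mod l = j}. sgn_bit (bit u q))"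
        by (intro prod.cong) (auto simp: sgn_bit_par intro!: prod.cong)
      also have "\<dots> = (\<Prod>q\<in>{q \<in> {..<n}. q mod l \<in> K}. sgn_bit (bit u q))"
        by (rule prod.group) (use K in auto)
      also have "\<dots> = (\<Prod>q<n. if q mod l \<in> K then sgn_bit (bit u q) else 1)"
        by (intro prod.mono_neutral_cong_left) auto
      finally show "(\<Prod>j\<in>K. \<i> * sgn_bit (?P j (bit u))) * (\<Prod>j\<in>J - K. 1) =
          \<i> ^ card K * (\<Prod>q<n. if q mod l \<in> K then sgn_bit (bit u q) else 1)"
        by (simp add: prod.distrib)
    qed
    finally show ?thesis .
  qed
  have "correlation n (blocks n l) x z =
      (\<Sum>u<(2::nat) ^ n. (\<Prod>j\<in>J. 1 / complex_of_real (sqrt 2)) * (\<Sum>K\<in>Pow J. \<i> ^ card K *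
        (\<Prod>q<n. sgn_bit (bit z q \<and> bit u q) * (cnj (?s (bit u q)) * ?s (bit x q \<noteq> bit u q)) *
          (if q mod l \<in> K then sgn_bit (bit u q) else 1))))"
    unfolding correlation_def
  proof (intro sum.cong refl)
    fix u :: nat
    have X: "bit (x XOR u) q \<longleftrightarrow> bit x q \<noteq> bit u q" for q by (simp add: bit_xor_iff)
    have "chi n z u * (cnj (fiducial n (blocks n l) (bit u)) * fiducial n (blocks n l) (bit (x XOR u))) =
        (chi n z u * ((\<Prod>q<n. cnj (?s (bit u q))) * (\<Prod>q<n. ?s (bit x q \<noteq> bit u q)))) *
        (cnj (\<Prod>j<l. if ?P j (bit u) then \<omega> else 1) * (\<Prod>j<l. if ?P j (bit (x XOR u)) then \<omega> else 1))"
      by (simp only: fiducial_blocks X complex_cnj_mult cnj_prod mult_ac)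
    then show "chi n z u * (cnj (fiducial n (blocks n l) (bit u)) * fiducial n (blocks n l) (bit (x XOR u))) =
      (\<Prod>j\<in>J. 1 / complex_of_real (sqrt 2)) * (\<Sum>K\<in>Pow J. \<i> ^ card K *
        (\<Prod>q<n. sgn_bit (bit z q \<and> bit u q) * (cnj (?s (bit u q)) * ?s (bit x q \<noteq> bit u q)) *
          (if q mod l \<in> K then sgn_bit (bit u q) else 1)))"
      unfolding phase prod.distrib chi_def by (simp only: sum_distrib_left mult_ac)
  qed
  also have "\<dots> = (\<Prod>j\<in>J. 1 / complex_of_real (sqrt 2)) * (\<Sum>K\<in>Pow J. \<i> ^ card K * (\<Sum>u<(2::nat) ^ n.
        (\<Prod>q<n. sgn_bit (bit z q \<and> bit u q) * (cnj (?s (bit u q)) * ?s (bit x q \<noteq> bit u q)) *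
          (if q mod l \<in> K then sgn_bit (bit u q) else 1))))"
    unfolding sum_distrib_left by (subst sum.swap) (rule refl)
  also have "\<dots> = (\<Prod>j\<in>J. 1 / complex_of_real (sqrt 2)) *
    (\<Sum>K\<in>Pow J. \<i> ^ card K * (\<Prod>q<n. qubit_factor (bit x q) (bit z q \<noteq> (q mod l \<in> K))))"
  proof -
    have "(\<Sum>u<(2::nat) ^ n.
        (\<Prod>q<n. sgn_bit (bit z q \<and> bit u q) * (cnj (?s (bit u q)) * ?s (bit x q \<noteq> bit u q)) *
          (if q mod l \<in> K then sgn_bit (bit u q) else 1))) =
        (\<Prod>q<n. qubit_factor (bit x q) (bit z q \<noteq> (q mod l \<in> K)))" for K
      unfolding sum_prod_bits[where n = n and F = "\<lambda>q b. sgn_bit (bit z q \<and> b) * (cnj (?s b) * ?s (bit x q \<noteq> b)) *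
          (if q mod l \<in> K then sgn_bit b else 1)"]
    proof (intro prod.cong refl)
      fix q
      show "sgn_bit (bit z q \<and> False) * (cnj (?s False) * ?s (bit x q \<noteq> False)) * (if q mod l \<in> K then sgn_bit False else 1)
          + sgn_bit (bit z q \<and> True) * (cnj (?s True) * ?s (bit x q \<noteq> True)) * (if q mod l \<in> K then sgn_bit True else 1)
          = qubit_factor (bit x q) (bit z q \<noteq> (q mod l \<in> K))"
        by (cases "bit x q"; cases "bit z q"; cases "q mod l \<in> K") (simp_all add: qubit_factor_def sgn_bit_def)
    qed
    then show ?thesis by simp
  qed
  finally show ?thesis .
qed

text \<open>In the expansion exactly one summand survives, so no cancellation can occur.\<close>

lemma correlation_nonzero:
  assumes l: "0 < l" and good: "\<And>j. j < l \<Longrightarrow> block_good (block n l j) (\<lambda>q. (bit x q, bit z q))"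
  shows "correlation n (blocks n l) x z \<noteq> 0"
proof -
  define J where "J = {j. j < l \<and> odd (card {q \<in> block n l j. bit x q})}"
  \<comment> \<open>In the odd blocks that contain an X the z labels must be flipped, to turn X into
    Y.\<close>
  define K0 where "K0 = {j \<in> J. \<exists>q\<in>block n l j. bit x q \<and> \<not> bit z q}"
  define g where "g K = \<i> ^ card K * (\<Prod>q<n. qubit_factor (bit x q) (bit z q \<noteq> (q mod l \<in> K)))" for K
  have finJ: "finite J" by (simp add: J_def)
  have "g K = 0" if K: "K \<subseteq> J" "K \<noteq> K0" for K
  proof -
    obtain j where j: "j \<in> J" "j \<in> K \<longleftrightarrow> j \<notin> K0" using K unfolding K0_def by blast
    \<comment> \<open>In the summand of K some qubit of block j becomes X: the one that put j into
      \<open>K0\<close> if j is left unflipped, and otherwise any Y of the block, which exists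
      because an odd block outside \<open>K0\<close> has x bits but no X.\<close>
    have "\<exists>q\<in>block n l j. bit x q \<and> (bit z q \<longleftrightarrow> j \<in> K)"
    proof (cases "j \<in> K0")
      case True
      then show ?thesis using j(2) unfolding K0_def by blast
    next
      case False
      have "odd (card {q \<in> block n l j. bit x q})" using j(1) unfolding J_def by blast
      then have "{q \<in> block n l j. bit x q} \<noteq> {}" by (metis card.empty even_zero)
      then obtain q where "q \<in> block n l j" "bit x q" by blast
      then show ?thesis using False j unfolding K0_def by blast
    qed
    then obtain q where "q \<in> block n l j" "bit x q" "bit z q \<longleftrightarrow> j \<in> K" by blast
    then have "q < n" "qubit_factor (bit x q) (bit z q \<noteq> (q mod l \<in> K)) = 0"
      by (auto simp: qubit_factor_eq_0_iff)
    then have "(\<Prod>q<n. qubit_factor (bit x q) (bit z q \<noteq> (q mod l \<in> K))) = 0"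
      by (intro prod_zero) auto
    then show ?thesis by (simp add: g_def)
  qed
  then have "(\<Sum>K\<in>Pow J. g K) = (\<Sum>K\<in>{K0}. g K)"
    by (intro sum.mono_neutral_right) (use finJ in \<open>auto simp: K0_def\<close>)
  moreover have "qubit_factor (bit x q) (bit z q \<noteq> (q mod l \<in> K0)) \<noteq> 0" if "q < n" for q
  proof -
    have q: "q \<in> block n l (q mod l)" "q mod l < l" using that l by auto
    have "\<not> (bit x q \<and> (bit z q \<longleftrightarrow> q mod l \<in> K0))"
    proof (cases "\<forall>p\<in>block n l (q mod l). (bit x p, bit z p) \<noteq> (True, False)")
      case True
      then have "q mod l \<notin> K0" unfolding K0_def by auto
      then show ?thesis using True q by auto
    next
      case False
      then have *: "odd (card {p \<in> block n l (q mod l). bit x p})"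
          "\<forall>p\<in>block n l (q mod l). (bit x p, bit z p) \<noteq> (True, True)"
        using good[OF q(2)] unfolding block_good_def by auto
      then have "q mod l \<in> K0" using False q(2) unfolding K0_def J_def by blast
      then show ?thesis using * q by auto
    qed
    then show ?thesis unfolding qubit_factor_eq_0_iff by blast
  qed
  then have "g K0 \<noteq> 0" unfolding g_def by (simp add: prod_zero_iff)
  ultimately show ?thesis
    unfolding correlation_expansion[OF l] J_def[symmetric] g_def[symmetric] by simp
qed

section \<open>Counting Paulis\<close>

text \<open>Weight values with P by -1 and the others by 1. The weights of A sum to 1, so the
  product over I expands to (even count) - (odd count) = 1, while both counts together give
  \<open>card A ^ card I\<close>.\<close>

lemma card_odd_PiE:
  fixes A :: "'b set" and P :: "'b \<Rightarrow> bool"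
  assumes "finite I" "finite A" "card {a\<in>A. \<not> P a} = card {a\<in>A. P a} + 1"
  shows "2 * card {h \<in> PiE I (\<lambda>_. A). odd (card {q\<in>I. P (h q)})} + 1 = card A ^ card I"
proof -
  let ?X = "PiE I (\<lambda>_. A)" and ?O = "{h \<in> PiE I (\<lambda>_. A). odd (card {q\<in>I. P (h q)})}"
  let ?s = "\<lambda>a. if P a then -1 else (1::int)"
  have fin: "finite ?X" using assms by (intro finite_PiE) auto
  have sgn: "(\<Prod>q\<in>I. ?s (h q)) = 1 - 2 * of_bool (odd (card {q\<in>I. P (h q)}))" for h
  proof -
    have "(\<Prod>q\<in>I. ?s (h q)) = (\<Prod>q\<in>{q\<in>I. P (h q)}. -1)"
      using assms(1) by (intro prod.mono_neutral_cong_right) auto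
    then show ?thesis by simp
  qed
  have "(\<Sum>a\<in>A. ?s a) = (\<Sum>a\<in>{a\<in>A. P a}. -1) + (\<Sum>a\<in>{a\<in>A. \<not> P a}. 1)"
    using assms(2) by (subst sum.If_cases) (auto simp: Int_def)
  then have "(\<Sum>a\<in>A. ?s a) = 1" using assms(3) by simp
  then have "1 = (\<Prod>q\<in>I. \<Sum>a\<in>A. ?s a)" by simp
  also have "\<dots> = (\<Sum>h\<in>?X. \<Prod>q\<in>I. ?s (h q))"
    using assms by (intro prod_sum_PiE) auto
  also have "\<dots> = int (card ?X) - 2 * (\<Sum>h\<in>?X. of_bool (odd (card {q\<in>I. P (h q)})))"
    unfolding sgn by (simp add: sum_subtractf sum_distrib_left)
  also have "(\<Sum>h\<in>?X. of_bool (odd (card {q\<in>I. P (h q)}))) = int (card ?O)"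
    using fin by (simp add: Int_def)
  finally have "int (2 * card ?O + 1) = int (card A ^ card I)" using assms(1) by (simp add: card_PiE)
  then show ?thesis by (simp only: of_nat_eq_iff)
qed

text \<open>A string meeting both criteria would have neither X nor Y, against the odd number of x
  bits; so the counts 3^k and (3^k - 1)/2 add up.\<close>

lemma card_block_good:
  assumes "finite I"
  shows "2 * card {h \<in> PiE I (\<lambda>_. UNIV). block_good I h} + 1 = 3 ^ (card I + 1)"
proof -
  let ?A = "UNIV - {(True, False)} :: (bool \<times> bool) set" and ?B = "UNIV - {(True, True)} :: (bool \<times> bool) set"
  let ?O = "{h \<in> PiE I (\<lambda>_. ?B). odd (card {q\<in>I. fst (h q)})}"
  have B: "{a \<in> ?B. fst a} = {(True, False)}" "{a \<in> ?B. \<not> fst a} = {(False, False), (False, True)}"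
    by auto
  have "?A = {(True, True), (False, True), (False, False)}" "?B = {(True, False), (False, True), (False, False)}"
    by auto
  then have cA: "card ?A = 3" "card ?B = 3" by simp_all
  have O: "2 * card ?O + 1 = 3 ^ card I"
    using card_odd_PiE[OF assms, of ?B fst] cA(2) unfolding B by simp
  have eq: "{h \<in> PiE I (\<lambda>_. UNIV). block_good I h} = PiE I (\<lambda>_. ?A) \<union> ?O"
    by (auto simp: block_good_def PiE_def Pi_def)
  have disj: "PiE I (\<lambda>_. ?A) \<inter> ?O = {}"
  proof (rule ccontr)
    assume "PiE I (\<lambda>_. ?A) \<inter> ?O \<noteq> {}"
    then obtain h where h: "h \<in> PiE I (\<lambda>_. ?A)" "h \<in> PiE I (\<lambda>_. ?B)" "odd (card {q\<in>I. fst (h q)})" by blast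
    then have "{q\<in>I. fst (h q)} \<noteq> {}" by (metis card.empty even_zero)
    then obtain q where q: "q \<in> I" "fst (h q)" by blast
    then have "h q \<noteq> (True, False)" "h q \<noteq> (True, True)" using h by auto
    then show False using q by (cases "h q") auto
  qed
  have "card {h \<in> PiE I (\<lambda>_. UNIV). block_good I h} = 3 ^ card I + card ?O"
    unfolding eq using assms cA(1)
    by (subst card_Un_disjoint[OF _ _ disj]) (auto simp: card_PiE intro!: finite_PiE finite_subset[of ?O "PiE I (\<lambda>_. ?B)"])
  then show ?thesis using O by simp
qed

definition good_paulis_set :: "nat \<Rightarrow> nat \<Rightarrow> (nat \<times> nat) set" where
  "good_paulis_set n l = {(x,z). x < 2 ^ n \<and> z < 2 ^ n \<and>
     (\<forall>j<l. block_good (block n l j) (\<lambda>q. (bit x q, bit z q)))}"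

lemma finite_good_paulis_set: "finite (good_paulis_set n l)"
  by (rule finite_subset[of _ "{..<2 ^ n} \<times> {..<2 ^ n}"]) (auto simp: good_paulis_set_def)

lemma block_good_cong: "(\<And>q. q \<in> I \<Longrightarrow> g q = h q) \<Longrightarrow> block_good I g = block_good I h"
proof -
  assume *: "\<And>q. q \<in> I \<Longrightarrow> g q = h q"
  then have "{q\<in>I. fst (g q)} = {q\<in>I. fst (h q)}" by auto
  then show ?thesis using * by (simp add: block_good_def)
qed

text \<open>Every qubit lies in exactly one residue class, so good strings chosen independently in
  the blocks glue to a Pauli that determines them.\<close>

lemma card_good_paulis_set:
  assumes "0 < l"
  shows "(\<Prod>j<l. card {h \<in> PiE (block n l j) (\<lambda>_. UNIV). block_good (block n l j) h}) \<le> card (good_paulis_set n l)"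
proof -
  let ?L = "\<lambda>j. {h \<in> PiE (block n l j) (\<lambda>_. UNIV). block_good (block n l j) h}"
  define \<Phi> where "\<Phi> H = (of_bits n (\<lambda>q. fst (H (q mod l) q)), of_bits n (\<lambda>q. snd (H (q mod l) q)))"
    for H :: "nat \<Rightarrow> nat \<Rightarrow> bool \<times> bool"
  have "card (PiE {..<l} ?L) \<le> card (good_paulis_set n l)"
  proof (rule card_inj_on_le[of \<Phi>])
    show "inj_on \<Phi> (PiE {..<l} ?L)"
    proof (rule inj_onI)
      fix H H' assume H: "H \<in> PiE {..<l} ?L" "H' \<in> PiE {..<l} ?L" and eq: "\<Phi> H = \<Phi> H'"
      have *: "H (q mod l) q = H' (q mod l) q" if "q < n" for q
      proof (rule prod_eqI)
        have "bit (fst (\<Phi> H)) q = bit (fst (\<Phi> H')) q" "bit (snd (\<Phi> H)) q = bit (snd (\<Phi> H')) q"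
          using eq by simp_all
        then show "fst (H (q mod l) q) = fst (H' (q mod l) q)" "snd (H (q mod l) q) = snd (H' (q mod l) q)"
          using that by (simp_all add: \<Phi>_def bit_of_bits)
      qed
      show "H = H'"
      proof (rule PiE_ext[OF H])
        fix j assume "j \<in> {..<l}"
        then have "H j \<in> PiE (block n l j) (\<lambda>_. UNIV)" "H' j \<in> PiE (block n l j) (\<lambda>_. UNIV)" using H by auto
        then show "H j = H' j" by (rule PiE_ext) (use * in auto)
      qed
    qed
    show "\<Phi> ` PiE {..<l} ?L \<subseteq> good_paulis_set n l"
    proof
      fix p assume "p \<in> \<Phi> ` PiE {..<l} ?L"
      then obtain H where H: "H \<in> PiE {..<l} ?L" "p = \<Phi> H" by blast
      have "block_good (block n l j) (\<lambda>q. (bit (fst p) q, bit (snd p) q))" if "j < l" for j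
      proof -
        have "block_good (block n l j) (H j)" using H(1) that by auto
        then show ?thesis
          by (subst block_good_cong[of _ _ "H j"]) (auto simp: H(2) \<Phi>_def bit_of_bits)
      qed
      moreover have "fst p < 2 ^ n" "snd p < 2 ^ n" by (simp_all add: H(2) \<Phi>_def of_bits_less)
      ultimately show "p \<in> good_paulis_set n l" by (auto simp: good_paulis_set_def split: prod.splits)
    qed
  qed (rule finite_good_paulis_set)
  then show ?thesis by (simp add: card_PiE)
qed

lemma card_block:
  assumes "r \<le> l" "j < l"
  shows "card (block (b * l + r) l j) = b + of_bool (j < r)"
proof -
  have "block (b * l + r) l j = (\<lambda>i. i * l + j) ` {..<b + of_bool (j < r)}"
  proof (intro equalityI subsetI)
    fix q assume q: "q \<in> block (b * l + r) l j"
    then have q': "q = q div l * l + j" using div_mult_mod_eq[of q l] by auto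
    have "q div l < b + of_bool (j < r)"
    proof (rule ccontr)
      assume "\<not> q div l < b + of_bool (j < r)"
      then have le: "(b + of_bool (j < r)) * l \<le> q div l * l" by (intro mult_right_mono) auto
      have lt: "q < b * l + r" using q by simp
      show False
      proof (cases "j < r")
        case True
        then have "b * l + l \<le> q div l * l" using le by simp
        then show False using lt q' assms(1) by linarith
      next
        case False
        then have "b * l \<le> q div l * l" using le by simp
        then show False using lt q' False by linarith
      qed
    qed
    then show "q \<in> (\<lambda>i. i * l + j) ` {..<b + of_bool (j < r)}" using q' by blast
  next
    fix q assume "q \<in> (\<lambda>i. i * l + j) ` {..<b + of_bool (j < r)}"
    then obtain i where i: "q = i * l + j" "i < b + of_bool (j < r)" by auto
    have "q < b * l + r"
    proof (cases "i < b")
      case True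
      then have "Suc i * l \<le> b * l" by (intro mult_right_mono) auto
      then show ?thesis using i assms by simp
    next
      case False
      then show ?thesis using i by (auto split: if_splits simp: of_bool_def less_Suc_eq)
    qed
    then show "q \<in> block (b * l + r) l j" using i assms by simp
  qed
  moreover have "inj_on (\<lambda>i. i * l + j) {..<b + of_bool (j < r)}"
    using assms by (auto simp: inj_on_def)
  ultimately show ?thesis by (simp add: card_image)
qed

section \<open>The lower bound\<close>

lemma valid_block_circ:
  assumes "g \<in> set (block_circ n (blocks n l))"
  shows "valid_gate (3 * n + 1) g"
proof -
  have "g \<in> set (map (\<lambda>q. CNOT q (2 * n + 1 + q)) [0..<n]) \<union> set (map Had [n + 1..<3 * n + 1]) \<union>
      set (map (\<lambda>q. CNOT (n + 1 + q) q) [0..<n]) \<union> (\<Union>q\<in>{0..<n}. set (HTH q)) \<or>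
      (\<exists>qs\<in>set (blocks n l). g \<in> set (parity_phase n qs))"
    using assms unfolding block_circ_def by auto
  then show ?thesis
  proof
    assume "\<exists>qs\<in>set (blocks n l). g \<in> set (parity_phase n qs)"
    then obtain qs where qs: "qs \<in> set (blocks n l)" "g \<in> set (parity_phase n qs)" by blast
    have "set qs \<subseteq> {..<n}" using qs(1) by (auto simp: blocks_def)
    then show ?thesis using qs(2) by (auto simp: parity_phase_def)
  qed (auto simp: HTH_def)
qed

lemma t_count_append: "t_count (gs @ hs) = t_count gs + t_count hs"
  by (simp add: t_count_def)

lemma t_count_concat: "t_count (concat gss) = (\<Sum>gs\<leftarrow>gss. t_count gs)"
  by (induction gss) (auto simp: t_count_def)

text \<open>For l > n some blocks are empty; their parity circuit is a lone T gate on the parity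
  ancilla, which keeps the count at exactly n + l.\<close>

lemma t_count_block_circ: "t_count (block_circ n (blocks n l)) = n + l"
proof -
  have "t_count (parity_phase n qs) = 1" "t_count (HTH q) = 1" for qs q
    by (simp_all add: t_count_def parity_phase_def HTH_def filter_map comp_def)
  moreover have "t_count (map Had as) = 0" "t_count (map (\<lambda>q. CNOT (c q) (d q)) as) = 0" for as c d
    by (simp_all add: t_count_def filter_map comp_def)
  ultimately show ?thesis
    by (simp add: block_circ_def blocks_def t_count_append t_count_concat comp_def sum_list_triv)
qed

lemma tdoped_s_ge:
  assumes "0 < l"
  obtains s where "tdoped_s n (n + l) s" "card (good_paulis_set n l) \<le> s"
proof -
  \<comment> \<open>Two registers of n ancillas for the random X and Z, and one parity
    ancilla.\<close>
  define m where "m = 2 * n + 1"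
  have nm: "n + m = 3 * n + 1" by (simp add: m_def)
  define \<psi> :: "complex vec" where "\<psi> = unit_vec (2 ^ m) 0"
  define gs where "gs = block_circ n (blocks n l)"
  define \<Phi> :: "nat \<Rightarrow> complex vec" where "\<Phi> = unit_vec (2 ^ (n + m))"
  define b where "b = (\<lambda>(u,v). of_bits (n + m) (outcome n u v))"
  define S where "S = {povm_elem n m \<psi> (circ_mat (n + m) gs) (\<Phi> b) | b. b < 2 ^ (n + m)}"
  define M where "M k = povm_elem n m \<psi> (circ_mat (n + m) gs) (\<Phi> (b k))" for k
  have valid: "\<And>g. g \<in> set gs \<Longrightarrow> valid_gate (n + m) g"
    unfolding nm gs_def by (rule valid_block_circ)
  have entry: "M (u,v) $$ (i,j) = cnj (povm_amp n (blocks n l) u v i) * povm_amp n (blocks n l) u v j"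
    if "i < 2 ^ n" "j < 2 ^ n" for u v i j
  proof -
    have bl: "b (u,v) < 2 ^ (n + m)" by (simp add: b_def of_bits_less)
    have row: "circ_mat (n + m) gs $$ (b (u,v), y) = povm_amp n (blocks n l) u v y" if y: "y < 2 ^ n" for y
    proof -
      have "y < 2 ^ (n + m)" using y by (rule less_le_trans) simp
      then have "circ_mat (n + m) gs $$ (b (u,v), y) =
          pulls gs (\<lambda>y. of_bool (\<forall>q<n + m. y q = bit (b (u,v)) q)) (bit y)"
        using valid bl by (intro circ_mat_row)
      also have "(\<lambda>y. of_bool (\<forall>q<n + m. y q = bit (b (u,v)) q)) =
          (\<lambda>y. of_bool (\<forall>q<3 * n + 1. y q = outcome n u v q) :: complex)"
        by (simp add: b_def bit_of_bits nm)
      also have "pulls gs \<dots> (bit y) = povm_amp n (blocks n l) u v y"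
        unfolding gs_def povm_amp_def
        by (subst pulls_block_circ) (use y in \<open>auto simp: blocks_def bit_xor_iff[abs_def]\<close>)
      finally show ?thesis .
    qed
    show ?thesis
      unfolding M_def \<psi>_def \<Phi>_def povm_elem_unit_vec[OF circ_mat_carrier bl that] row[OF that(1)] row[OF that(2)] ..
  qed
  have "card (good_paulis_set n l) \<le> span_dim (2 ^ n) S"
  proof (rule span_dim_ge_card)
    show "finite ({..<2 ^ n} \<times> {..<2 ^ n} :: (nat \<times> nat) set)" by simp
    show "M k \<in> S" for k
      unfolding M_def S_def by (auto simp: b_def of_bits_less split: prod.splits)
    show "pauli_fun n g (i,j) = (\<Sum>k\<in>{..<2 ^ n} \<times> {..<2 ^ n}.
        (case g of (x,z) \<Rightarrow> case k of (u,v) \<Rightarrow> chi n v x * chi n z u * 2 ^ n / correlation n (blocks n l) x z) * M k $$ (i,j))"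
      if "g \<in> good_paulis_set n l" "i < 2 ^ n" "j < 2 ^ n" for g i j
    proof -
      obtain x z where g: "g = (x,z)" by (cases g)
      have "correlation n (blocks n l) x z \<noteq> 0"
        by (rule correlation_nonzero[OF assms]) (use that(1) g in \<open>auto simp: good_paulis_set_def\<close>)
      then have "pauli_fun n (x,z) (i,j) =
        (\<Sum>(u,v)\<in>{..<2 ^ n} \<times> {..<2 ^ n}. chi n v x * chi n z u * 2 ^ n / correlation n (blocks n l) x z *
          (cnj (povm_amp n (blocks n l) u v i) * povm_amp n (blocks n l) u v j))"
        using that g by (intro pauli_fun_decomposition) (auto simp: good_paulis_set_def)
      also have "\<dots> = (\<Sum>k\<in>{..<2 ^ n} \<times> {..<2 ^ n}.
        (case g of (x,z) \<Rightarrow> case k of (u,v) \<Rightarrow> chi n v x * chi n z u * 2 ^ n / correlation n (blocks n l) x z) * M k $$ (i,j))"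
        by (intro sum.cong refl) (auto simp: g entry[OF that(2,3)])
      finally show ?thesis unfolding g .
    qed
    show "(\<Sum>p\<in>{..<2 ^ n} \<times> {..<2 ^ n}. pauli_fun n g p * pauli_fun n h p) = (if g = h then 2 ^ n else 0)"
      if gh: "g \<in> good_paulis_set n l" "h \<in> good_paulis_set n l" for g h
    proof -
      obtain x z x' z' where eq: "g = (x,z)" "h = (x',z')" by (cases g; cases h)
      show ?thesis unfolding eq
        by (rule pauli_fun_orthogonal) (use gh in \<open>auto simp: eq good_paulis_set_def\<close>)
    qed
  qed (auto simp: finite_good_paulis_set)
  moreover have "tdoped_s n (n + l) (span_dim (2 ^ n) S)"
    unfolding tdoped_s_def S_def
  proof (intro exI conjI)
    show "stabilizer_state m \<psi>" unfolding \<psi>_def by (rule stabilizer_state_unit_vec)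
    show "stabilizer_basis (n + m) \<Phi>" unfolding \<Phi>_def by (rule stabilizer_basis_unit_vec)
    show "t_count gs = n + l" unfolding gs_def by (rule t_count_block_circ)
    show "\<forall>g\<in>set gs. valid_gate (n + m) g" using valid by blast
  qed (rule refl)
  ultimately show thesis by (intro that)
qed

lemma card_good_paulis_set_ge:
  assumes "r < l" "n + l = a * l + r"
  shows "(3 ^ (a + 1) - 1) ^ r * (3 ^ a - 1) ^ (l - r) / 2 ^ l \<le> real (card (good_paulis_set n l))"
proof -
  \<comment> \<open>As n + l = a l + r with r < l, the data qubits fill a - 1 full rounds of
    residues and r further ones. The round lost here returns in the exponent k + 1 of the count for
    a block of k qubits.\<close>
  have "a \<noteq> 0" using assms by (cases a) auto
  then obtain b where a: "a = Suc b" by (cases a) auto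
  then have n: "n = b * l + r" using assms(2) by simp
  let ?c = "\<lambda>j. card {h \<in> PiE (block n l j) (\<lambda>_. UNIV). block_good (block n l j) h}"
  have c: "real (?c j) = (if j < r then 3 ^ (a + 1) - 1 else 3 ^ a - 1) / 2" if "j < l" for j
  proof -
    have "card (block n l j) + 1 = a + of_bool (j < r)"
      using card_block[of r l j b] assms that by (simp add: n a)
    then have "2 * ?c j + 1 = 3 ^ (a + of_bool (j < r))"
      using card_block_good[of "block n l j"] by simp
    then have "real (2 * ?c j + 1) = real (3 ^ (a + of_bool (j < r)))" by (simp only:)
    then show ?thesis by auto
  qed
  have sets: "{..<l} \<inter> {j. j < r} = {..<r}" "{..<l} \<inter> - {j. j < r} = {r..<l}" using assms(1) by auto
  have "(3 ^ (a + 1) - 1) ^ r * (3 ^ a - 1) ^ (l - r) / 2 ^ l =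
      (\<Prod>j<l. (if j < r then 3 ^ (a + 1) - 1 else 3 ^ a - 1) / (2::real))"
    by (simp add: prod_dividef prod.If_cases sets)
  also have "\<dots> = (\<Prod>j<l. real (?c j))"
    by (rule prod.cong[OF refl], rule c[symmetric]) simp
  also have "\<dots> \<le> real (card (good_paulis_set n l))"
    unfolding of_nat_prod[symmetric] of_nat_le_iff
    by (rule card_good_paulis_set) (use assms in simp)
  finally show ?thesis .
qed

theorem theorem7:
  fixes n t :: nat
  assumes "1 \<le> n" and "n < t"
  defines "l \<equiv> t - n"
    and "a \<equiv> t div (t - n)"
    and "r \<equiv> t - (t div (t - n)) * (t - n)"
    and "A \<equiv> Max {s. tdoped_s n t s}"
  shows "(\<forall>s. tdoped_s n t s \<longrightarrow> s \<le> A) \<and>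
         real A \<ge> (3 ^ (a + 1) - 1) ^ r * (3 ^ a - 1) ^ (l - r) / 2 ^ l"
proof -
  \<comment> \<open>The bound 4^n does not depend on the number of ancillas, so A is a maximum over
    a finite set although m is unbounded.\<close>
  have "finite {s. tdoped_s n t s}"
    by (rule finite_subset[of _ "{..2 ^ n * 2 ^ n}"]) (use span_dim_le in \<open>auto simp: tdoped_s_def\<close>)
  then have max: "s \<le> A" if "tdoped_s n t s" for s
    unfolding A_def using that by (intro Max_ge) auto
  have l: "0 < l" "n + l = t" using assms(2) by (simp_all add: l_def)
  have "r = t mod l" unfolding r_def l_def by (simp add: minus_div_mult_eq_mod)
  then have r: "r < l" "n + l = a * l + r"
    using l by (simp_all add: a_def l_def[symmetric])
  obtain s where "tdoped_s n t s" "card (good_paulis_set n l) \<le> s"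
    using tdoped_s_ge[OF l(1), of n] unfolding l(2) by blast
  then have "real (card (good_paulis_set n l)) \<le> real A" using max by fastforce
  with card_good_paulis_set_ge[OF r] have "(3 ^ (a + 1) - 1) ^ r * (3 ^ a - 1) ^ (l - r) / 2 ^ l \<le> real A"
    by (rule order_trans)
  then show ?thesis using max by blast
qed

end
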